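(* Let $f:S^1\to[0,\infty)$ be a continuous function without zeros and of bounded variation. Then $$\mathbf{ucat}(f)=\max\{2,M^+(f)\}=\max\{2,M^-(f)\}.$$
   Context: A continuous function $u:X\to[0,\infty)$ on a topological space is unimodal if there is $M>0$ such that the superlevel set $u^{-1}[c,\infty)$ is contractible for $0<c\le M$ and empty for $c>M$. The unimodal category $\mathbf{ucat}(f)$ of $f:X\to[0,\infty)$ is the minimum number $n$ of unimodal functions $u_1,\dots,u_n:X\to[0,\infty)$ with $f=\sum_{i=1}^n u_i$ pointwise ($\infty$ if there is no such $n$). $f:S^1\to[0,\infty)$ has bounded variation if the function $[0,1]\to[0,\infty)$, $t\mapsto f(\exp(2\pi i t))$, has bounded variation. For an interval $I\subseteq\mathbb R$, $V^-(F;I)=\sup\sum_{i=1}^k\max\{0,F(t_{i-1})-F(t_i)\}$, the supremum over all finite sequences $t_0<\dots<t_k$ of points of $I$. For a function $F:J\to[0,\infty)$ on an interval $J\subseteq\mathbb R$, an open interval $(x,y)\subseteq J$ with $x<y$ is forced-max with respect to $F$ if $V^-(F;(x,y))>F(x)$; below, $J=(-\infty,1]$, $F$ vanishes near $-\infty$, intervals with $x=-\infty$ are allowed, and $F(-\infty)=0$. $M(F)$ is the maximum number of pairwise disjoint open forced-max intervals contained in $J$. For $g:[0,1]\to[0,\infty)$, its extension $\hat g:\mathbb R\to[0,\infty)$ is $\hat g(x)=(x+1)g(0)$ for $x\in[-1,0]$, $\hat g(x)=g(x)$ for $x\in[0,1]$, $\hat g(x)=(2-x)g(1)$ for $x\in[1,2]$,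 and $\hat g(x)=0$ for $x\notin[-1,2]$. For $a\in S^1$ (the unit circle in $\mathbb C$), let $f_a^+(t)=f(a\exp(2\pi i t))$ and $f_a^-(t)=f(a\exp(-2\pi i t))$ for $t\in[0,1]$. Put $M_a^{\pm}(f)=M(\widehat{f_a^{\pm}}|_{(-\infty,1]})$ and $M^{\pm}(f)=\min_{a\in S^1}M_a^{\pm}(f)$. *)

theory Defs
  imports "HOL-Analysis.Analysis" "HOL-Library.Extended_Nat"
begin

text \<open>Functions on a space are represented by functions on the surrounding type, of which only
  the values on the carrier \<open>X\<close> (resp. \<open>J\<close>, \<open>sphere 0 1\<close>, \<open>{0..1}\<close>) matter.\<close>

text \<open>The library predicate \<^const>\<open>contractible\<close> holds for the empty set, whereas a contractible
  space is nonempty here; hence the explicit nonemptiness condition. In particular the zero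
  function is not unimodal.\<close>

definition unimodal :: "'a::topological_space set \<Rightarrow> ('a \<Rightarrow> real) \<Rightarrow> bool" where
  "unimodal X u \<longleftrightarrow>
     continuous_on X u \<and> (\<forall>x\<in>X. 0 \<le> u x) \<and>
     (\<exists>M>0. (\<forall>c. 0 < c \<and> c \<le> M \<longrightarrow> {x\<in>X. c \<le> u x} \<noteq> {} \<and> contractible {x\<in>X. c \<le> u x}) \<and>
            (\<forall>c>M. {x\<in>X. c \<le> u x} = {}))"

text \<open>The infimum in \<^typ>\<open>enat\<close> is \<open>\<infinity>\<close> for the empty set and a minimum otherwise.\<close>

definition ucat :: "'a::topological_space set \<Rightarrow> ('a \<Rightarrow> real) \<Rightarrow> enat" where
  "ucat X f = Inf {enat n |n. \<exists>u :: nat \<Rightarrow> 'a \<Rightarrow> real.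
     (\<forall>i<n. unimodal X (u i)) \<and> (\<forall>x\<in>X. f x = (\<Sum>i<n. u i x))}"

text \<open>\<open>(k, t) \<in> chains I\<close> encodes a finite sequence \<open>t 0 < \<dots> < t k\<close> of points of \<open>I\<close>.\<close>

definition chains :: "real set \<Rightarrow> (nat \<times> (nat \<Rightarrow> real)) set" where
  "chains I = {(k, t). t ` {..k} \<subseteq> I \<and> strict_mono_on {..k} t}"

definition has_bounded_variation_on :: "(real \<Rightarrow> real) \<Rightarrow> real set \<Rightarrow> bool" where
  "has_bounded_variation_on F I \<longleftrightarrow>
     (\<exists>B. \<forall>(k, t)\<in>chains I. (\<Sum>i<k. \<bar>F (t (Suc i)) - F (t i)\<bar>) \<le> B)"

definition neg_variation :: "(real \<Rightarrow> real) \<Rightarrow> real set \<Rightarrow> ennreal" where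
  "neg_variation F I =
     (SUP (k, t)\<in>chains I. ennreal (\<Sum>i<k. max 0 (F (t i) - F (t (Suc i)))))"

text \<open>Intervals are given by extended real endpoints, so that the left endpoint may be \<open>-\<infinity>\<close>,
  where \<open>F\<close> is given the value 0; this is meant for \<open>F\<close> vanishing near \<open>-\<infinity>\<close> if \<open>J\<close> is unbounded
  below.\<close>

definition forced_max :: "real set \<Rightarrow> (real \<Rightarrow> real) \<Rightarrow> ereal \<Rightarrow> ereal \<Rightarrow> bool" where
  "forced_max J F x y \<longleftrightarrow>
     x < y \<and> einterval x y \<subseteq> J \<and>
     neg_variation F (einterval x y) > ennreal (if x = -\<infinity> then 0 else F (real_of_ereal x))"

text \<open>The supremum is a maximum unless there are arbitrarily large families, in which case it
  is \<open>\<infinity>\<close>.\<close>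

definition max_forced :: "real set \<Rightarrow> (real \<Rightarrow> real) \<Rightarrow> enat" where
  "max_forced J F =
     (SUP P \<in> {P. finite P \<and> (\<forall>(x, y)\<in>P. forced_max J F x y) \<and>
                  disjoint_family_on (\<lambda>(x, y). einterval x y) P}. enat (card P))"

definition extension :: "(real \<Rightarrow> real) \<Rightarrow> real \<Rightarrow> real" where
  "extension g x =
     (if -1 \<le> x \<and> x \<le> 0 then (x + 1) * g 0
      else if 0 \<le> x \<and> x \<le> 1 then g x
      else if 1 \<le> x \<and> x \<le> 2 then (2 - x) * g 1
      else 0)"

definition loop_plus :: "(complex \<Rightarrow> real) \<Rightarrow> complex \<Rightarrow> real \<Rightarrow> real" where
  "loop_plus f a t = f (a * exp (2 * of_real pi * \<i> * of_real t))"

definition loop_minus :: "(complex \<Rightarrow> real) \<Rightarrow> complex \<Rightarrow> real \<Rightarrow> real" where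
  "loop_minus f a t = f (a * exp (- 2 * of_real pi * \<i> * of_real t))"

definition circle_bounded_variation :: "(complex \<Rightarrow> real) \<Rightarrow> bool" where
  "circle_bounded_variation f \<longleftrightarrow>
     has_bounded_variation_on (\<lambda>t. f (exp (2 * of_real pi * \<i> * of_real t))) {0..1}"

text \<open>The infima over the circle are minima, since \<^typ>\<open>enat\<close> is well-ordered.\<close>

definition M_plus :: "(complex \<Rightarrow> real) \<Rightarrow> enat" where
  "M_plus f = (INF a\<in>sphere 0 1. max_forced {..1} (extension (loop_plus f a)))"

definition M_minus :: "(complex \<Rightarrow> real) \<Rightarrow> enat" where
  "M_minus f = (INF a\<in>sphere 0 1. max_forced {..1} (extension (loop_minus f a)))"

end

theory Submission
  imports Defs
begin

text \<open>
  A unimodal function on the circle has arcs as superlevel sets and vanishes somewhere: going around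
  once from a zero, it rises to its maximum and falls again. Both inequalities rest on this picture.

  Lower bound. Let \<open>f\<close> be the sum of \<open>n\<close> unimodal functions \<open>u 0, \<dots>, u (n - 1)\<close>, and start reading the
  circle at a maximum of \<open>u 0\<close>. If an interval with left end point \<open>x \<ge> 0\<close> is forced-max, \<open>f\<close> descends on it
  by more than \<open>f x\<close>, the sum of the \<open>u i x\<close>. Hence some \<open>u i\<close> descends by more than \<open>u i x\<close>; as \<open>u i\<close> is
  nonnegative, it must have risen in between, that is, it has a strict peak
  (\<open>forced_max_peak\<close>). During one turn each \<open>u i\<close> has at most one peak
  (\<open>unimodal_circle_one_peak\<close>), and \<open>u 0\<close> has none, as the turn starts at its maximum
  (\<open>unimodal_circle_no_peak_from_max\<close>). Since the extension does not descend before \<open>0\<close>, a forced-max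
  interval with left end point below \<open>0\<close> reaches beyond \<open>0\<close>, and there is at most one of these in a
  disjoint family. Altogether there are at most \<open>n\<close>. Moreover \<open>n \<ge> 2\<close>, because a single unimodal
  function has a zero.

  Upper bound. By bounded variation, the descent of the loop is measured by a continuous
  nondecreasing function (\<open>continuous_negative_variation\<close>). Cut the circle greedily: the
  first cut point is the end of the initial stretch without descent, and after a cut point go on as
  long as the descent since then does not exceed the value of \<open>f\<close> there. If this does not close the
  circle with \<open>n\<close> segments, it produces \<open>n + 1\<close> disjoint forced-max intervals
  (\<open>greedy_dichotomy\<close>). If it does, \<open>f\<close> is on each segment the sum of a part that falls from the value at
  its beginning to \<open>0\<close> and a part that rises from \<open>0\<close> to the value at its end (\<open>split_segment\<close>). The
  rising part of a segment and the falling part of the next one form a unimodal function whose maximum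
  is at their common cut point, provided that there are at least two segments
  (\<open>circle_sum_of_unimodal\<close>). These \<open>n\<close> functions add up to \<open>f\<close>.

  Complex conjugation reverses the orientation of the circle and changes neither the unimodal
  category nor bounded variation, so the second equality follows from the first.
\<close>

section \<open>Unimodal functions on the circle\<close>

definition circ :: "real \<Rightarrow> complex" where
  "circ t = exp (2 * of_real pi * \<i> * of_real t)"

lemma circ_eq_cis: "circ t = cis (2 * pi * t)"
  by (simp add: circ_def cis_conv_exp mult_ac)

lemma circ_add: "circ (s + t) = circ s * circ t"
  by (simp add: circ_eq_cis cis_mult algebra_simps)

lemma circ_1 [simp]: "circ 1 = 1"
  by (simp add: circ_eq_cis)

lemma circ_add_1 [simp]: "circ (t + 1) = circ t"
  by (simp add: circ_add)

lemma circ_diff_1 [simp]: "circ (t - 1) = circ t"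
  using circ_add_1 [of "t - 1"] by simp

lemma norm_circ [simp]: "norm (circ t) = 1"
  by (simp add: circ_eq_cis)

lemma circ_in_sphere: "circ t \<in> sphere 0 1"
  by simp

lemma continuous_on_circ: "continuous_on S circ"
  unfolding circ_def by (intro continuous_intros)

lemma circ_surj:
  assumes "z \<in> sphere 0 1"
  obtains t where "\<alpha> \<le> t" "t < \<alpha> + 1" "z = circ t"
proof -
  define s where "s = Arg z / (2 * pi)"
  have s: "circ s = z"
    using assms cis_Arg[of z] by (force simp: circ_eq_cis s_def sgn_div_norm)
  define t where "t = s - of_int \<lfloor>s - \<alpha>\<rfloor>"
  have "circ t = circ s * cis (2 * pi * (- of_int \<lfloor>s - \<alpha>\<rfloor>))"
    by (simp add: circ_eq_cis cis_mult t_def algebra_simps)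
  also have "cis (2 * pi * (- of_int \<lfloor>s - \<alpha>\<rfloor>)) = 1"
    by (metis cis_multiple_2pi Ints_of_int Ints_minus)
  finally have "z = circ t" using s by simp
  moreover have "\<alpha> \<le> t" "t < \<alpha> + 1" unfolding t_def by linarith+
  ultimately show thesis using that by blast
qed

lemma circ_inj:
  assumes "circ s = circ t" "\<bar>s - t\<bar> < 1"
  shows "s = t"
proof -
  have "cis (2 * pi * s - 2 * pi * t) = 1"
    using assms(1) by (simp add: circ_eq_cis cis_divide[symmetric])
  hence "cos (2 * pi * s - 2 * pi * t) = 1" by (simp add: complex_eq_iff)
  then obtain n :: int where "2 * pi * s - 2 * pi * t = of_int n * 2 * pi"
    unfolding cos_one_2pi_int by auto
  hence "2 * pi * (s - t) = 2 * pi * of_int n" by (simp add: algebra_simps)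
  hence st: "s - t = of_int n" by simp
  hence "\<bar>n\<bar> < 1" using assms(2) by linarith
  thus ?thesis using st by simp
qed

text \<open>Height above the diameter perpendicular to \<open>circ m\<close>: two points of the circle symmetric
  about \<open>circ m\<close> cut it into the part above and the part below their common height.\<close>

definition height :: "real \<Rightarrow> complex \<Rightarrow> real" where
  "height m z = Re (z * circ (- m))"

lemma height_circ: "height m (circ t) = cos (2 * pi * (t - m))"
proof -
  have "circ t * circ (- m) = circ (t - m)" using circ_add[of t "- m"] by simp
  thus ?thesis by (simp add: height_def circ_eq_cis)
qed

text \<open>The points \<open>circ s\<close> and \<open>circ r\<close> separate \<open>circ q\<close> from \<open>circ q'\<close>: with \<open>m\<close> midway
  between \<open>s\<close> and \<open>r\<close>, they are the only points at height \<open>cos (pi * (r - s))\<close>, a value which a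
  connected set reaching both sides must attain.\<close>

lemma connected_arc:
  assumes S: "connected S" "S \<subseteq> sphere 0 1"
    and "circ q \<in> S" "circ q' \<in> S" and order: "s < q" "q < r" "r < q'" "q' < s + 1"
  shows "circ s \<in> S \<or> circ r \<in> S"
proof -
  define m where "m = (s + r) / 2"
  define \<kappa> where "\<kappa> = cos (pi * (r - s))"
  have rs: "0 \<le> pi * (r - s)" "pi * (r - s) \<le> pi" using order by auto
  have inside: "\<kappa> < height m (circ t)" if "s < t" "t < r" for t
  proof -
    have "\<bar>2 * (t - m)\<bar> < r - s" using that by (simp add: m_def field_simps abs_less_iff)
    hence "pi * \<bar>2 * (t - m)\<bar> < pi * (r - s)" by simp
    hence "cos (pi * (r - s)) < cos (pi * \<bar>2 * (t - m)\<bar>)"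
      using rs by (intro cos_monotone_0_pi) auto
    also have "pi * \<bar>2 * (t - m)\<bar> = \<bar>2 * pi * (t - m)\<bar>"
      by (simp only: abs_mult abs_of_pos[OF pi_gt_zero] abs_numeral mult_ac)
    also have "cos \<dots> = cos (2 * pi * (t - m))" by simp
    finally show ?thesis by (simp add: \<kappa>_def height_circ)
  qed
  have outside: "height m (circ t) < \<kappa>" if "r < t" "t < s + 1" for t
  proof -
    define d where "d = pi - \<bar>pi - 2 * pi * (t - m)\<bar>"
    have "\<bar>1 - 2 * (t - m)\<bar> < 1 - (r - s)"
      using that order by (simp add: m_def field_simps abs_less_iff)
    hence "pi * \<bar>1 - 2 * (t - m)\<bar> < pi * (1 - (r - s))" by simp
    moreover have "pi * \<bar>1 - 2 * (t - m)\<bar> = \<bar>pi * (1 - 2 * (t - m))\<bar>"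
      by (simp only: abs_mult abs_of_pos[OF pi_gt_zero])
    moreover have "pi * (1 - 2 * (t - m)) = pi - 2 * pi * (t - m)"
      by (simp add: algebra_simps)
    ultimately have "pi * (r - s) < d" by (simp add: d_def algebra_simps)
    hence "cos d < \<kappa>" unfolding \<kappa>_def
      using rs by (intro cos_monotone_0_pi) (auto simp: d_def)
    moreover have "cos d = - cos \<bar>pi - 2 * pi * (t - m)\<bar>"
      unfolding d_def by (simp only: cos_diff cos_pi sin_pi)
    hence "cos d = cos (2 * pi * (t - m))"
      by (simp only: cos_abs_real cos_diff[of pi] cos_pi sin_pi)
    ultimately show ?thesis by (simp add: height_circ)
  qed
  have "continuous_on S (height m)" unfolding height_def by (intro continuous_intros)
  hence "connected (height m ` S)" using S(1) by (rule connected_continuous_image)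
  moreover have "height m (circ q) \<in> height m ` S" "height m (circ q') \<in> height m ` S"
    using assms(3,4) by auto
  moreover have "height m (circ q') \<le> \<kappa>" "\<kappa> \<le> height m (circ q)"
    using inside[of q] outside[of q'] order by auto
  ultimately have "\<kappa> \<in> height m ` S" using connectedD_interval by blast
  then obtain z where z: "z \<in> S" "height m z = \<kappa>" by auto
  obtain t where t: "s \<le> t" "t < s + 1" "z = circ t" using circ_surj z(1) S(2) by blast
  have "t = s \<or> t = r"
    using inside[of t] outside[of t] z(2) t by force
  thus ?thesis using z(1) t(3) by auto
qed

lemma unimodal_superlevel_connected:
  fixes X :: "'a::real_normed_vector set"
  assumes u: "unimodal X u" and "0 < c"
  shows "connected {x \<in> X. c \<le> u x}"
proof -
  obtain M where "\<And>c. 0 < c \<Longrightarrow> c \<le> M \<Longrightarrow> contractible {x \<in> X. c \<le> u x}"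
    "\<And>c. M < c \<Longrightarrow> {x \<in> X. c \<le> u x} = {}"
    using u unfolding unimodal_def by blast
  note M = this
  show ?thesis
  proof (cases "c \<le> M")
    case True
    show ?thesis by (rule contractible_imp_connected, rule M(1)[OF \<open>0 < c\<close> True])
  next
    case False
    hence "M < c" by simp
    show ?thesis unfolding M(2)[OF \<open>M < c\<close>] by (rule connected_empty)
  qed
qed

text \<open>If the minimum were positive, the superlevel set at that level would be the whole circle,
  which is not contractible. This is why a positive function needs at least two summands.\<close>

lemma unimodal_circle_zero:
  assumes u: "unimodal (sphere (0::complex) 1) u"
  obtains z where "z \<in> sphere 0 1" "u z = 0"
proof -
  let ?S = "sphere (0::complex) 1"
  have cont: "continuous_on ?S u" using u by (simp only: unimodal_def)
  obtain z where z: "z \<in> ?S" "\<And>w. w \<in> ?S \<Longrightarrow> u z \<le> u w"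
    using continuous_attains_inf[OF compact_sphere _ cont] circ_in_sphere by blast
  have "u z = 0"
  proof (rule ccontr)
    assume "u z \<noteq> 0"
    moreover have "0 \<le> u z" using u z(1) unfolding unimodal_def by blast
    ultimately have pos: "0 < u z" by simp
    have eq: "{x \<in> ?S. u z \<le> u x} = ?S" using z(2) by auto
    obtain M where M: "\<And>c. 0 < c \<Longrightarrow> c \<le> M \<Longrightarrow> contractible {x \<in> ?S. c \<le> u x}"
      "\<And>c. M < c \<Longrightarrow> {x \<in> ?S. c \<le> u x} = {}"
      using u unfolding unimodal_def by blast
    have "\<not> M < u z" using M(2)[of "u z"] z(1) unfolding eq by blast
    hence "contractible {x \<in> ?S. u z \<le> u x}" using M(1)[OF pos] by simp
    hence "contractible ?S" unfolding eq .
    thus False by (simp add: contractible_sphere)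
  qed
  thus thesis using that z(1) by blast
qed

text \<open>Superlevel sets are connected, so going once around the circle a unimodal function cannot be
  low, high, low, high.\<close>

lemma unimodal_circle_no_two_valleys:
  assumes u: "unimodal (sphere 0 1) u"
    and order: "s < q" "q < r" "r < q'" "q' < s + 1"
    and "u (circ s) < u (circ q)" "u (circ s) < u (circ q')"
        "u (circ r) < u (circ q)" "u (circ r) < u (circ q')"
  shows False
proof -
  define c where "c = min (u (circ q)) (u (circ q'))"
  have "0 \<le> u (circ s)" using u circ_in_sphere unfolding unimodal_def by blast
  hence "0 < c" using assms by (auto simp: c_def)
  hence "connected {z \<in> sphere 0 1. c \<le> u z}" by (rule unimodal_superlevel_connected[OF u])
  hence "circ s \<in> {z \<in> sphere 0 1. c \<le> u z} \<or> circ r \<in> {z \<in> sphere 0 1. c \<le> u z}"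
    by (rule connected_arc[OF _ _ _ _ order]) (auto simp: c_def)
  thus False using assms by (auto simp: c_def)
qed

text \<open>The circle is a quotient of the compact interval: a closed set of parameters has a compact,
  hence closed, image on the circle.\<close>

lemma continuous_on_circle_descend:
  fixes u :: "complex \<Rightarrow> real"
  assumes U: "continuous_on {\<beta>..\<beta> + 1} U" and u: "\<And>t. t \<in> {\<beta>..\<beta> + 1} \<Longrightarrow> u (circ t) = U t"
  shows "continuous_on (sphere 0 1) u"
  unfolding continuous_on_closed_vimage[OF closed_sphere]
proof (intro allI impI)
  fix C :: "real set" assume "closed C"
  hence "closed (U -` C \<inter> {\<beta>..\<beta> + 1})"
    using U continuous_on_closed_vimage[OF closed_atLeastAtMost] by blast
  hence "compact (U -` C \<inter> {\<beta>..\<beta> + 1})"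
    by (meson bounded_Int bounded_closed_interval compact_eq_bounded_closed)
  hence "compact (circ ` (U -` C \<inter> {\<beta>..\<beta> + 1}))"
    by (intro compact_continuous_image continuous_on_circ)
  moreover have "u -` C \<inter> sphere 0 1 = circ ` (U -` C \<inter> {\<beta>..\<beta> + 1})"
  proof (intro equalityI subsetI)
    fix z assume z: "z \<in> u -` C \<inter> sphere 0 1"
    then obtain t where "\<beta> \<le> t" "t < \<beta> + 1" "z = circ t" using circ_surj[of z \<beta>] by blast
    thus "z \<in> circ ` (U -` C \<inter> {\<beta>..\<beta> + 1})" using z u[of t] by (intro image_eqI[of _ _ t]) auto
  qed (use u in auto)
  ultimately show "closed (u -` C \<inter> sphere 0 1)" by (simp add: compact_imp_closed)
qed

lemma circle_function_of_loop:
  fixes U :: "real \<Rightarrow> real"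
  assumes U: "continuous_on {\<beta>..\<beta> + 1} U" and ends: "U (\<beta> + 1) = U \<beta>"
  obtains u where "continuous_on (sphere 0 1) u" "\<And>t. t \<in> {\<beta>..\<beta> + 1} \<Longrightarrow> u (circ t) = U t"
proof -
  define \<tau> where "\<tau> z = (SOME t. \<beta> \<le> t \<and> t < \<beta> + 1 \<and> circ t = z)" for z
  have \<tau>: "\<beta> \<le> \<tau> z \<and> \<tau> z < \<beta> + 1 \<and> circ (\<tau> z) = z" if z: "z \<in> sphere 0 1" for z
    unfolding \<tau>_def by (rule someI_ex) (use circ_surj[OF z, of \<beta>] in metis)
  have eq: "(U \<circ> \<tau>) (circ t) = U t" if t: "t \<in> {\<beta>..\<beta> + 1}" for t
  proof (cases "t = \<beta> + 1")
    case True
    have "\<tau> (circ \<beta>) = \<beta>" using \<tau>[of "circ \<beta>"] by (intro circ_inj) auto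
    thus ?thesis using True ends by simp
  next
    case False
    have "\<tau> (circ t) = t" using \<tau>[of "circ t"] t False by (intro circ_inj) auto
    thus ?thesis by simp
  qed
  show thesis using that[OF continuous_on_circle_descend[OF U]] eq by blast
qed

text \<open>Starting at a zero, a rise followed by a fall makes every superlevel set of positive level
  the image of a compact interval that omits the end points, on which \<open>circ\<close> is injective; so it is
  homeomorphic to an interval.\<close>

lemma unimodal_circleI:
  fixes u :: "complex \<Rightarrow> real"
  assumes cont: "continuous_on (sphere 0 1) u"
    and m: "\<alpha> \<le> m" "m \<le> \<alpha> + 1" and zero: "u (circ \<alpha>) = 0" and pos: "0 < u (circ m)"
    and up: "\<And>s t. \<alpha> \<le> s \<Longrightarrow> s \<le> t \<Longrightarrow> t \<le> m \<Longrightarrow> u (circ s) \<le> u (circ t)"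
    and down: "\<And>s t. m \<le> s \<Longrightarrow> s \<le> t \<Longrightarrow> t \<le> \<alpha> + 1 \<Longrightarrow> u (circ t) \<le> u (circ s)"
  shows "unimodal (sphere 0 1) u"
proof -
  define U where "U t = u (circ t)" for t
  have ends: "U \<alpha> = 0" "U (\<alpha> + 1) = 0" using zero by (auto simp: U_def)
  have contU: "continuous_on {\<alpha>..\<alpha> + 1} U"
    unfolding U_def by (rule continuous_on_compose2[OF cont continuous_on_circ]) auto
  have max: "U t \<le> U m" if "\<alpha> \<le> t" "t \<le> \<alpha> + 1" for t
    using up[of t m] down[of m t] that m by (cases "t \<le> m") (auto simp: U_def)
  have nonneg: "0 \<le> U t" if "\<alpha> \<le> t" "t \<le> \<alpha> + 1" for t
    using up[of \<alpha> t] down[of t "\<alpha> + 1"] that m ends by (cases "t \<le> m") (auto simp: U_def)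
  have contr: "contractible {z \<in> sphere 0 1. c \<le> u z}" if c: "0 < c" for c
  proof -
    define T where "T = {t \<in> {\<alpha>..\<alpha> + 1}. c \<le> U t}"
    have "is_interval T"
      unfolding is_interval_1
    proof (intro ballI allI impI)
      fix a b x assume a: "a \<in> T" and b: "b \<in> T" and x: "a \<le> x \<and> x \<le> b"
      have "U a \<le> U x \<or> U b \<le> U x"
        using up[of a x] down[of x b] a b x m
        by (cases "x \<le> m") (auto simp: U_def T_def)
      thus "x \<in> T" using a b x by (auto simp: T_def)
    qed
    hence "contractible T" by (simp add: is_interval_contractible_1)
    have "compact T"
    proof -
      have "closed (U -` {c..} \<inter> {\<alpha>..\<alpha> + 1})"
        using contU continuous_on_closed_vimage[OF closed_atLeastAtMost] closed_atLeast by blast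
      moreover have "T = U -` {c..} \<inter> {\<alpha>..\<alpha> + 1}" by (auto simp: T_def)
      ultimately show ?thesis
        by (metis bounded_Int bounded_closed_interval compact_eq_bounded_closed)
    qed
    moreover have "inj_on circ T"
    proof (rule inj_onI)
      fix s t assume st: "s \<in> T" "t \<in> T" and eq: "circ s = circ t"
      have inner: "\<alpha> < x \<and> x < \<alpha> + 1" if "x \<in> T" for x
        using that ends c by (auto simp: T_def less_le)
      show "s = t" using inner[OF st(1)] inner[OF st(2)] by (intro circ_inj[OF eq]) (simp add: abs_less_iff)
    qed
    ultimately have "T homeomorphic circ ` T"
      using homeomorphic_compact[OF _ continuous_on_circ] by blast
    moreover have "circ ` T = {z \<in> sphere 0 1. c \<le> u z}"
    proof (intro equalityI subsetI)
      fix z assume z: "z \<in> {z \<in> sphere 0 1. c \<le> u z}"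
      then obtain t where "\<alpha> \<le> t" "t < \<alpha> + 1" "z = circ t" using circ_surj[of z \<alpha>] by blast
      thus "z \<in> circ ` T" using z by (intro image_eqI[of _ _ t]) (auto simp: T_def U_def)
    qed (auto simp: T_def U_def)
    ultimately show ?thesis
      using \<open>contractible T\<close> by (metis homeomorphic_contractible)
  qed
  have range: "0 \<le> u z \<and> u z \<le> U m" if z: "z \<in> sphere 0 1" for z
  proof -
    obtain t where "\<alpha> \<le> t" "t < \<alpha> + 1" "z = circ t" using circ_surj[OF z] .
    thus ?thesis using max[of t] nonneg[of t] by (simp add: U_def)
  qed
  have "{z \<in> sphere 0 1. c \<le> u z} \<noteq> {}" if "c \<le> U m" for c
    using that circ_in_sphere[of m] unfolding U_def by blast
  moreover have "{z \<in> sphere 0 1. c \<le> u z} = {}" if "U m < c" for c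
    using range that by fastforce
  ultimately have "\<exists>M>0. (\<forall>c. 0 < c \<and> c \<le> M \<longrightarrow>
      {z \<in> sphere 0 1. c \<le> u z} \<noteq> {} \<and> contractible {z \<in> sphere 0 1. c \<le> u z}) \<and>
      (\<forall>c>M. {z \<in> sphere 0 1. c \<le> u z} = {})"
    using contr pos by (intro exI[of _ "U m"]) (simp add: U_def)
  thus ?thesis unfolding unimodal_def using cont range by blast
qed

section \<open>Negative variation\<close>

text \<open>\<open>drop_sum F s t v\<close> holds if \<open>v\<close> is the total descent of \<open>F\<close> along a finite increasing chain
  from \<open>s\<close> to \<open>t\<close>. The inductive form makes concatenating and subdividing chains easy;
  \<open>drop_sum_of_chain\<close> and \<open>chain_of_drop_sum\<close> translate from and to indexed chains.\<close>

inductive drop_sum :: "(real \<Rightarrow> real) \<Rightarrow> real \<Rightarrow> real \<Rightarrow> real \<Rightarrow> bool" for F where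
  stop: "drop_sum F s s 0"
| step: "s < r \<Longrightarrow> drop_sum F r t v \<Longrightarrow> drop_sum F s t (max 0 (F s - F r) + v)"

lemma drop_sum_le: "drop_sum F s t v \<Longrightarrow> s \<le> t"
  by (induction rule: drop_sum.induct) auto

lemma drop_sum_single: "s \<le> t \<Longrightarrow> drop_sum F s t (max 0 (F s - F t))"
  using drop_sum.step[OF _ drop_sum.stop, of s t F] by (cases "s = t") (auto intro: drop_sum.stop)

lemma drop_sum_append:
  "drop_sum F s m v \<Longrightarrow> drop_sum F m t w \<Longrightarrow> drop_sum F s t (v + w)"
  by (induction rule: drop_sum.induct) (auto simp: add.assoc intro: drop_sum.intros)

text \<open>Inserting the point \<open>m\<close> into a chain does not decrease its total descent.\<close>

lemma drop_sum_split:
  assumes "drop_sum F s t v" "s \<le> m" "m \<le> t"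
  shows "\<exists>v1 v2. drop_sum F s m v1 \<and> drop_sum F m t v2 \<and> v \<le> v1 + v2"
  using assms
proof (induction rule: drop_sum.induct)
  case (stop s)
  hence "m = s" by simp
  thus ?case using drop_sum.stop[of F s] by (intro exI[of _ 0]) auto
next
  case (step s r t v)
  show ?case
  proof (cases "m < r")
    case True
    hence "drop_sum F m t (max 0 (F m - F r) + v)" using step.hyps by (intro drop_sum.step)
    moreover have "drop_sum F s m (max 0 (F s - F m))" using step.prems by (intro drop_sum_single)
    ultimately show ?thesis by (intro exI conjI) (assumption+, auto)
  next
    case False
    then obtain v1 v2 where v: "drop_sum F r m v1" "drop_sum F m t v2" "v \<le> v1 + v2"
      using step by fastforce
    have "drop_sum F s m (max 0 (F s - F r) + v1)" using step.hyps(1) v(1) by (rule drop_sum.step)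
    with v show ?thesis by (intro exI conjI) (assumption+, auto)
  qed
qed

lemma drop_sum_translate:
  assumes "drop_sum F s t v" "\<And>x. s \<le> x \<Longrightarrow> x \<le> t \<Longrightarrow> F x = F' (x + c)"
  shows "drop_sum F' (s + c) (t + c) v"
  using assms
proof (induction rule: drop_sum.induct)
  case (step s r t v)
  have "drop_sum F' (r + c) (t + c) v" using step by simp
  moreover have "F s = F' (s + c)" "F r = F' (r + c)"
    using step.prems[of s] step.prems[of r] step.hyps drop_sum_le[OF step.hyps(2)] by auto
  ultimately show ?case using step.hyps(1) drop_sum.step[of "s + c" "r + c" F'] by simp
qed (rule drop_sum.stop)

text \<open>Among the functions whose increments bound the descents of \<open>F\<close>, the negative variation has
  the least increments; its continuity rests on this minimality.\<close>

lemma drop_sum_le_increment: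
  assumes "drop_sum F s t v"
    and "\<And>x y. s \<le> x \<Longrightarrow> x \<le> y \<Longrightarrow> y \<le> t \<Longrightarrow> max 0 (F x - F y) \<le> H y - H x"
  shows "v \<le> H t - H s"
  using assms
proof (induction rule: drop_sum.induct)
  case (step s r t v)
  have "r \<le> t" using step.hyps(2) by (rule drop_sum_le)
  have "v \<le> H t - H r" using step.prems step.hyps(1) by (intro step.IH) auto
  moreover have "max 0 (F s - F r) \<le> H r - H s"
    using step.hyps(1) \<open>r \<le> t\<close> by (intro step.prems) auto
  ultimately show ?case by linarith
qed simp

lemma drop_sum_of_chain:
  assumes "strict_mono_on {..k} c"
  shows "drop_sum F (c 0) (c k) (\<Sum>i<k. max 0 (F (c i) - F (c (Suc i))))"
  using assms
proof (induction k arbitrary: c)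
  case 0
  show ?case by (simp add: drop_sum.stop)
next
  case (Suc k)
  have "drop_sum F (c (Suc 0)) (c (Suc k)) (\<Sum>i<k. max 0 (F (c (Suc i)) - F (c (Suc (Suc i)))))"
    using Suc.prems by (intro Suc.IH[of "\<lambda>i. c (Suc i)"]) (auto simp: strict_mono_on_def)
  moreover have "c 0 < c (Suc 0)" using Suc.prems by (auto simp: strict_mono_on_def)
  ultimately show ?case by (simp add: sum.lessThan_Suc_shift drop_sum.step del: sum.lessThan_Suc)
qed

lemma chain_of_drop_sum:
  assumes "drop_sum F s t v"
  shows "\<exists>k c. (k, c) \<in> chains {s..t} \<and> v = (\<Sum>i<k. max 0 (F (c i) - F (c (Suc i))))"
proof -
  have "\<exists>k c. c 0 = s \<and> c k = t \<and> strict_mono_on {..k} c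
              \<and> v = (\<Sum>i<k. max 0 (F (c i) - F (c (Suc i))))"
    using assms
  proof (induction rule: drop_sum.induct)
    case (stop s)
    show ?case by (intro exI[of _ 0] exI[of _ "\<lambda>_. s"]) (auto simp: strict_mono_on_def)
  next
    case (step s r t v)
    then obtain k c where c: "c 0 = r" "c k = t" "strict_mono_on {..k} c"
        "v = (\<Sum>i<k. max 0 (F (c i) - F (c (Suc i))))" by blast
    have ge: "s < c i" if "i \<le> k" for i
      using that c step.hyps(1) by (cases "i = 0") (force simp: strict_mono_on_def)+
    have "strict_mono_on {..Suc k} (case_nat s c)"
      using c(3) ge by (auto simp: strict_mono_on_def split: nat.splits)
    thus ?case using c(1,2,4)
      by (intro exI[of _ "Suc k"] exI[of _ "case_nat s c"])
        (simp add: sum.lessThan_Suc_shift del: sum.lessThan_Suc)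
  qed
  then obtain k c where c: "c 0 = s" "c k = t" "strict_mono_on {..k} c"
      "v = (\<Sum>i<k. max 0 (F (c i) - F (c (Suc i))))" by blast
  have "s \<le> c i \<and> c i \<le> t" if "i \<le> k" for i
    using c that strict_mono_on_leD[OF c(3), of 0 i] strict_mono_on_leD[OF c(3), of i k] by auto
  hence "(k, c) \<in> chains {s..t}" using c(3) by (auto simp: chains_def)
  thus ?thesis using c(4) by blast
qed

lemma bounded_drop_sums:
  assumes "has_bounded_variation_on F {a..b}"
  shows "\<exists>B. \<forall>s t v. a \<le> s \<longrightarrow> t \<le> b \<longrightarrow> drop_sum F s t v \<longrightarrow> v \<le> B"
proof -
  obtain B where B: "\<And>k c. (k, c) \<in> chains {a..b} \<Longrightarrow> (\<Sum>i<k. \<bar>F (c (Suc i)) - F (c i)\<bar>) \<le> B"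
    using assms unfolding has_bounded_variation_on_def by blast
  have "v \<le> B" if "a \<le> s" "t \<le> b" "drop_sum F s t v" for s t v
  proof -
    obtain k c where c: "(k, c) \<in> chains {s..t}" "v = (\<Sum>i<k. max 0 (F (c i) - F (c (Suc i))))"
      using chain_of_drop_sum[OF \<open>drop_sum F s t v\<close>] by blast
    have "v \<le> (\<Sum>i<k. \<bar>F (c (Suc i)) - F (c i)\<bar>)" unfolding c(2) by (intro sum_mono) auto
    also have "\<dots> \<le> B" using c(1) that(1,2) by (intro B) (auto simp: chains_def)
    finally show ?thesis .
  qed
  thus ?thesis by blast
qed

text \<open>Equivalently, both \<open>N\<close> and \<open>F + N\<close> are nondecreasing: \<open>F\<close> is written as a difference of
  nondecreasing functions of which the subtracted one, \<open>N\<close>, is continuous.\<close>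

definition dominates_drops :: "(real \<Rightarrow> real) \<Rightarrow> (real \<Rightarrow> real) \<Rightarrow> real set \<Rightarrow> bool" where
  "dominates_drops N F I \<longleftrightarrow>
     continuous_on I N \<and> (\<forall>s\<in>I. \<forall>t\<in>I. s \<le> t \<longrightarrow> max 0 (F s - F t) \<le> N t - N s)"

text \<open>The function \<open>N\<close> is the negative variation counted from \<open>a\<close>. If it had a jump at some point
  then, \<open>F\<close> being continuous there, the jump could be removed without losing the domination of
  descents, against minimality. The second property says that the increments of \<open>N\<close> do not exceed
  the variation; by continuity of \<open>N\<close> the chains can be taken in the open interval.\<close>

lemma continuous_negative_variation:
  fixes F :: "real \<Rightarrow> real"
  assumes ab: "a \<le> b" and cont: "continuous_on {a..b} F"
    and bdd: "\<And>v. drop_sum F a b v \<Longrightarrow> v \<le> B"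
  obtains N where "dominates_drops N F {a..b}"
    "\<And>s t v. a \<le> s \<Longrightarrow> s < t \<Longrightarrow> t \<le> b \<Longrightarrow> v < N t - N s \<Longrightarrow>
       \<exists>(k, c)\<in>chains {s<..<t}. v < (\<Sum>i<k. max 0 (F (c i) - F (c (Suc i))))"
proof -
  define N where "N t = Sup {v. drop_sum F a t v}" for t
  have ne: "{v. drop_sum F a t v} \<noteq> {}" if "a \<le> t" for t using drop_sum_single[OF that] by blast
  have above: "bdd_above {v. drop_sum F a t v}" if "t \<le> b" for t
  proof (rule bdd_aboveI)
    fix v assume "v \<in> {v. drop_sum F a t v}"
    hence "drop_sum F a b (v + max 0 (F t - F b))"
      using drop_sum_append drop_sum_single[OF that] by blast
    from bdd[OF this] show "v \<le> B" by linarith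
  qed
  have upper: "v \<le> N t" if "drop_sum F a t v" "t \<le> b" for t v
    unfolding N_def using that above by (intro cSup_upper) auto
  have super: "N s + v \<le> N t" if v: "drop_sum F s t v" and s: "a \<le> s" and t: "t \<le> b" for s t v
  proof -
    have "w \<le> N t - v" if "drop_sum F a s w" for w
      using upper[OF drop_sum_append[OF that v] t] by simp
    hence "N s \<le> N t - v" unfolding N_def[of s] using ne[OF s] by (intro cSup_least) auto
    thus ?thesis by simp
  qed
  have drops: "max 0 (F s - F t) \<le> N t - N s" if "a \<le> s" "s \<le> t" "t \<le> b" for s t
    using super[OF drop_sum_single, of s t] that by linarith
  have tight: "\<exists>w. drop_sum F s t w \<and> v < w" if st: "a \<le> s" "s \<le> t" "t \<le> b" and v: "v < N t - N s" for s t v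
  proof -
    have "v + N s < Sup {v. drop_sum F a t v}" using v by (simp add: N_def)
    then obtain x where x: "drop_sum F a t x" "v + N s < x"
      using less_cSupD[OF ne] st by (metis (no_types, lifting) mem_Collect_eq order_trans)
    then obtain v1 v2 where "drop_sum F a s v1" "drop_sum F s t v2" "x \<le> v1 + v2"
      using drop_sum_split st by blast
    moreover have "v1 \<le> N s" using upper \<open>drop_sum F a s v1\<close> st by auto
    ultimately show ?thesis using x(2) by (intro exI[of _ v2]) auto
  qed
  have minimal: "J \<le> 0"
    if H: "\<And>x y. a \<le> x \<Longrightarrow> x \<le> y \<Longrightarrow> y \<le> b \<Longrightarrow> max 0 (F x - F y) \<le> H y - H x"
      and Hb: "H b - H a = N b - N a - J" for H J
  proof (rule ccontr)
    assume "\<not> J \<le> 0"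
    hence "N b - N a - J < N b - N a" by simp
    then obtain w where "drop_sum F a b w" "N b - N a - J < w" using tight[of a b "N b - N a - J"] ab by auto
    moreover have "w \<le> H b - H a" by (rule drop_sum_le_increment[OF \<open>drop_sum F a b w\<close>]) (use H in auto)
    ultimately show False using Hb by simp
  qed
  have right: "\<exists>r. x < r \<and> r \<le> b \<and> N r - N x < e" if x: "a \<le> x" "x < b" and e: "0 < e" for x e
  proof (rule ccontr)
    assume no: "\<not> ?thesis"
    hence jump: "e \<le> N r - N x" if "x < r" "r \<le> b" for r using that by force
    \<comment> \<open>\<open>H\<close> is \<open>N\<close> with an amount \<open>e\<close> of the supposed jump at \<open>x\<close> taken out.\<close>
    define H where "H y = N y - (if x < y then e else 0)" for y
    have "e \<le> 0"
    proof (rule minimal[of H])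
      show "H b - H a = N b - N a - e" using x by (simp add: H_def)
      fix p y assume py: "a \<le> p" "p \<le> y" "y \<le> b"
      show "max 0 (F p - F y) \<le> H y - H p"
      proof (cases "p \<le> x \<and> x < y")
        case True
        define K where "K = N y - N p - e"
        have K: "0 \<le> K \<and> F r \<le> K + F y + F x - F p" if r: "r \<in> {x<..<y}" for r
          using drops[of p x] drops[of r y] jump[of r] r True py x unfolding K_def by auto
        \<comment> \<open>The bound holds for every \<open>r\<close> just after the jump; by continuity of \<open>F\<close> it passes to
          \<open>r = x\<close>, where \<open>F r\<close> and \<open>F x\<close> cancel.\<close>
        have "continuous_on (closure {x<..<y}) F"
          using True x py by (intro continuous_on_subset[OF cont]) auto
        hence "F x \<le> K + F y + F x - F p"
          by (rule continuous_le_on_closure) (use K True in auto)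
        moreover have "0 \<le> K" using K[of "(x + y) / 2"] True by simp
        ultimately show ?thesis using True by (simp add: H_def K_def)
      next
        case False
        thus ?thesis using drops[OF py] py(2) by (auto simp: H_def)
      qed
    qed
    thus False using e by simp
  qed
  have left: "\<exists>r. a \<le> r \<and> r < x \<and> N x - N r < e" if x: "a < x" "x \<le> b" and e: "0 < e" for x e
  proof (rule ccontr)
    assume no: "\<not> ?thesis"
    hence jump: "e \<le> N x - N r" if "a \<le> r" "r < x" for r using that by force
    define H where "H y = N y - (if x \<le> y then e else 0)" for y
    have "e \<le> 0"
    proof (rule minimal[of H])
      show "H b - H a = N b - N a - e" using x by (simp add: H_def)
      fix p y assume py: "a \<le> p" "p \<le> y" "y \<le> b"
      show "max 0 (F p - F y) \<le> H y - H p"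
      proof (cases "p < x \<and> x \<le> y")
        case True
        define K where "K = N y - N p - e"
        have K: "0 \<le> K \<and> F p + F x - F y - K \<le> F r" if r: "r \<in> {p<..<x}" for r
          using drops[of p r] drops[of x y] jump[of r] r True py x unfolding K_def by auto
        have "continuous_on (closure {p<..<x}) F"
          using True x py by (intro continuous_on_subset[OF cont]) auto
        hence "F p + F x - F y - K \<le> F x"
          by (rule continuous_ge_on_closure) (use K True in auto)
        moreover have "0 \<le> K" using K[of "(p + x) / 2"] True by simp
        ultimately show ?thesis using True by (simp add: H_def K_def)
      next
        case False
        thus ?thesis using drops[OF py] py(2) by (auto simp: H_def)
      qed
    qed
    thus False using e by simp
  qed
  have mono: "N s \<le> N t" if "a \<le> s" "s \<le> t" "t \<le> b" for s t using drops[OF that] by simp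
  have contN: "continuous_on {a..b} N"
    unfolding continuous_on_iff
  proof (intro ballI allI impI)
    fix x e :: real assume x: "x \<in> {a..b}" and e: "0 < e"
    obtain r where r: "x < r" "\<forall>y\<in>{a..b}. x \<le> y \<longrightarrow> y < r \<longrightarrow> N y - N x < e"
    proof (cases "x < b")
      case True
      then obtain r where "x < r" "r \<le> b" "N r - N x < e" using right[of x e] x e by auto
      thus thesis using that[of r] mono x by (smt (verit) atLeastAtMost_iff)
    next
      case False
      thus thesis using that[of "x + 1"] x e by force
    qed
    obtain l where l: "l < x" "\<forall>y\<in>{a..b}. y \<le> x \<longrightarrow> l < y \<longrightarrow> N x - N y < e"
    proof (cases "a < x")
      case True
      then obtain r where "a \<le> r" "r < x" "N x - N r < e" using left[of x e] x e by auto
      thus thesis using that[of r] mono x by (smt (verit) atLeastAtMost_iff)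
    next
      case False
      thus thesis using that[of "x - 1"] x e by force
    qed
    have "dist (N y) (N x) < e" if y: "y \<in> {a..b}" "dist y x < min (r - x) (x - l)" for y
    proof (cases "x \<le> y")
      case True
      thus ?thesis using r y mono[of x y] x by (auto simp: dist_real_def)
    next
      case False
      thus ?thesis using l y mono[of y x] x by (auto simp: dist_real_def)
    qed
    thus "\<exists>d>0. \<forall>y\<in>{a..b}. dist y x < d \<longrightarrow> dist (N y) (N x) < e"
      using r(1) l(1) by (intro exI[of _ "min (r - x) (x - l)"]) auto
  qed
  have dom: "dominates_drops N F {a..b}"
    unfolding dominates_drops_def using contN drops by auto
  have "\<exists>(k, c)\<in>chains {s<..<t}. v < (\<Sum>i<k. max 0 (F (c i) - F (c (Suc i))))"
    if st: "a \<le> s" "s < t" "t \<le> b" and v: "v < N t - N s" for s t v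
  proof -
    define e where "e = (N t - N s - v) / 2"
    have e: "0 < e" using v by (simp add: e_def)
    obtain s1 where s1: "s < s1" "s1 \<le> b" "N s1 - N s < e" using right[of s e] st e by auto
    obtain t1 where t1: "a \<le> t1" "t1 < t" "N t - N t1 < e" using left[of t e] st e by auto
    define s' where "s' = min s1 ((s + t) / 2)"
    define t' where "t' = max t1 ((s + t) / 2)"
    have order: "s < s'" "s' \<le> t'" "t' < t" using st s1 t1 by (auto simp: s'_def t'_def)
    have "N s' \<le> N s1" "N t1 \<le> N t'"
      using st s1 t1 order by (auto intro!: mono simp: s'_def t'_def)
    hence "v < N t' - N s'" using s1 t1 by (simp add: e_def field_simps)
    then obtain w where w: "drop_sum F s' t' w" "v < w" using tight[of s' t' v] order st by auto
    obtain k c where c: "(k, c) \<in> chains {s'..t'}" "w = (\<Sum>i<k. max 0 (F (c i) - F (c (Suc i))))"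
      using chain_of_drop_sum[OF w(1)] by blast
    have "(k, c) \<in> chains {s<..<t}" using c(1) order by (force simp: chains_def)
    thus ?thesis using c(2) w(2) by blast
  qed
  thus thesis using that dom by blast
qed

section \<open>Gluing a decomposition from segments\<close>

lemma dominates_drops_subset:
  assumes "dominates_drops N F I" "J \<subseteq> I"
  shows "dominates_drops N F J"
  using assms continuous_on_subset[of I N J] unfolding dominates_drops_def by blast

text \<open>On a segment where \<open>G\<close> descends in total by at most \<open>G s\<close>, it splits as \<open>d + (G - d)\<close> where
  \<open>d\<close> falls from \<open>G s\<close> to \<open>0\<close> and \<open>G - d\<close> rises from \<open>0\<close> to \<open>G t\<close>. The falling part is \<open>G s\<close> minus the
  descent so far; what this leaves at \<open>t\<close> is used up by an additional linear decrease, which the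
  rising part compensates. Extending \<open>d\<close> by constants will make all functions of the
  decomposition continuous without case distinctions.\<close>

lemma split_segment:
  fixes G :: "real \<Rightarrow> real"
  assumes st: "s < t" and dom: "dominates_drops N G {s..t}" and cont: "continuous_on {s..t} G"
    and small: "N t - N s \<le> G s"
  obtains d where "continuous_on UNIV d" "antimono d"
    "\<And>x. x \<le> s \<Longrightarrow> d x = G s" "\<And>x. t \<le> x \<Longrightarrow> d x = 0"
    "\<And>x y. s \<le> x \<Longrightarrow> x \<le> y \<Longrightarrow> y \<le> t \<Longrightarrow> G x - d x \<le> G y - d y"
proof -
  define L where "L = G s - (N t - N s)"
  define e where "e x = G s - (N x - N s) - L * (x - s) / (t - s)" for x
  \<comment> \<open>Clamping the argument to the segment extends the falling part by constants.\<close>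
  define p where "p x = max s (min x t)" for x
  have p: "p x \<in> {s..t}" for x using st by (auto simp: p_def)
  have L: "0 \<le> L" using small by (simp add: L_def)
  have slope: "L * (x - s) / (t - s) \<le> L * (y - s) / (t - s)" if "x \<le> y" for x y
    using st L that by (intro divide_right_mono mult_left_mono) auto
  have drop: "max 0 (G x - G y) \<le> N y - N x" if "s \<le> x" "x \<le> y" "y \<le> t" for x y
    using dom that unfolding dominates_drops_def by auto
  show thesis
  proof (rule that[of "\<lambda>x. e (p x)"])
    have "continuous_on {s..t} e"
      unfolding e_def using dom st by (intro continuous_intros) (auto simp: dominates_drops_def)
    moreover have "continuous_on UNIV p"
      unfolding p_def by (intro continuous_intros)
    ultimately show "continuous_on UNIV (\<lambda>x. e (p x))"
      by (rule continuous_on_compose2) (use p in auto)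
    show "antimono (\<lambda>x. e (p x))"
    proof (rule antimonoI)
      fix x y :: real assume "x \<le> y"
      hence "p x \<le> p y" by (auto simp: p_def)
      thus "e (p y) \<le> e (p x)"
        using drop[of "p x" "p y"] slope[of "p x" "p y"] p[of x] p[of y] by (auto simp: e_def)
    qed
    show "e (p x) = G s" if "x \<le> s" for x
    proof -
      have "p x = s" using that st by (auto simp: p_def)
      thus ?thesis by (simp add: e_def)
    qed
    show "e (p x) = 0" if "t \<le> x" for x
    proof -
      have "p x = t" using that st by (auto simp: p_def)
      thus ?thesis using st by (simp add: e_def L_def)
    qed
    show "G x - e (p x) \<le> G y - e (p y)" if "s \<le> x" "x \<le> y" "y \<le> t" for x y
    proof -
      have "p x = x" "p y = y" using that by (auto simp: p_def)
      thus ?thesis using drop[OF that] slope[OF that(2)] by (simp add: e_def)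
    qed
  qed
qed

lemma increasing_upto:
  fixes z :: "nat \<Rightarrow> real"
  assumes "\<And>i. i < n \<Longrightarrow> z i < z (Suc i)" "i \<le> j" "j \<le> n"
  shows "z i \<le> z j"
  using assms(2,3)
proof (induction j)
  case (Suc j)
  thus ?case using assms(1)[of j] by (cases "i = Suc j") auto
qed simp

text \<open>Split \<open>f\<close> on each segment into a falling part \<open>d i\<close> and a rising part. The rising part of one
  segment and the falling part of the next meet in the common value of \<open>f\<close> at the cut point and
  together form a unimodal function with its maximum there. Since there are at least two
  segments, it vanishes at the other cut points, as unimodality on the circle requires.\<close>

lemma circle_sum_of_unimodal:
  fixes f :: "complex \<Rightarrow> real" and y :: "nat \<Rightarrow> real"
  assumes f: "continuous_on (sphere 0 1) f" "\<And>z. z \<in> sphere 0 1 \<Longrightarrow> 0 < f z"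
    and n: "2 \<le> n" and around: "y n = y 0 + 1"
    and dom: "dominates_drops N (\<lambda>t. f (circ t)) {y 0..y n}"
    and seg: "\<And>i. i < n \<Longrightarrow> y i < y (Suc i) \<and> N (y (Suc i)) - N (y i) \<le> f (circ (y i))"
  shows "\<exists>u :: nat \<Rightarrow> complex \<Rightarrow> real. (\<forall>i<n. unimodal (sphere 0 1) (u i)) \<and>
           (\<forall>z\<in>sphere 0 1. f z = (\<Sum>i<n. u i z))"
proof -
  define G where "G t = f (circ t)" for t
  have contG: "continuous_on A G" for A
    unfolding G_def by (rule continuous_on_compose2[OF f(1) continuous_on_circ]) auto
  have posG: "0 < G t" for t using f(2) by (simp add: G_def)
  have ymono: "y i \<le> y j" if "i \<le> j" "j \<le> n" for i j
    using increasing_upto[of n y i j] seg that by blast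
  have "\<exists>d. continuous_on UNIV d \<and> antimono d \<and>
      (\<forall>x\<le>y i. d x = G (y i)) \<and> (\<forall>x\<ge>y (Suc i). d x = 0) \<and>
      (\<forall>x z. y i \<le> x \<longrightarrow> x \<le> z \<longrightarrow> z \<le> y (Suc i) \<longrightarrow> G x - d x \<le> G z - d z)" if i: "i < n" for i
  proof -
    have "{y i..y (Suc i)} \<subseteq> {y 0..y n}" using ymono[of 0 i] ymono[of "Suc i" n] i by auto
    hence "dominates_drops N G {y i..y (Suc i)}"
      using dom dominates_drops_subset unfolding G_def by blast
    moreover have "y i < y (Suc i)" "N (y (Suc i)) - N (y i) \<le> G (y i)"
      using seg[OF i] by (auto simp: G_def)
    ultimately obtain d where "continuous_on UNIV d" "antimono d"
      "\<And>x. x \<le> y i \<Longrightarrow> d x = G (y i)" "\<And>x. y (Suc i) \<le> x \<Longrightarrow> d x = 0"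
      "\<And>x z. y i \<le> x \<Longrightarrow> x \<le> z \<Longrightarrow> z \<le> y (Suc i) \<Longrightarrow> G x - d x \<le> G z - d z"
      using split_segment[OF _ _ contG] by blast
    thus ?thesis by blast
  qed
  hence "\<forall>i. \<exists>d. i < n \<longrightarrow> continuous_on UNIV d \<and> antimono d \<and>
      (\<forall>x\<le>y i. d x = G (y i)) \<and> (\<forall>x\<ge>y (Suc i). d x = 0) \<and>
      (\<forall>x z. y i \<le> x \<longrightarrow> x \<le> z \<longrightarrow> z \<le> y (Suc i) \<longrightarrow> G x - d x \<le> G z - d z)" by blast
  from choice[OF this] obtain d where d:
      "\<And>i. i < n \<Longrightarrow> continuous_on UNIV (d i)" "\<And>i. i < n \<Longrightarrow> antimono (d i)"
      "\<And>i x. i < n \<Longrightarrow> x \<le> y i \<Longrightarrow> d i x = G (y i)"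
      "\<And>i x. i < n \<Longrightarrow> y (Suc i) \<le> x \<Longrightarrow> d i x = 0"
      "\<And>i x z. i < n \<Longrightarrow> y i \<le> x \<Longrightarrow> x \<le> z \<Longrightarrow> z \<le> y (Suc i) \<Longrightarrow> G x - d i x \<le> G z - d i z"
    by blast
  \<comment> \<open>\<open>E i\<close> vanishes up to \<open>y i\<close>, is the rising part on the segment from \<open>y i\<close>, and equals \<open>G\<close> after
    it. The difference of two consecutive ones is the summand with maximum at the later cut
    point, so that the sum telescopes.\<close>
  define E where "E i t = G (max t (y i)) - d i t" for i t
  have contE: "continuous_on A (E i)" if "i < n" for A i
    unfolding E_def
    by (intro continuous_intros continuous_on_compose2[OF contG[of UNIV]]
        continuous_on_subset[OF d(1)[OF that]]) auto
  have E_left: "E i t = 0" if "i < n" "t \<le> y i" for i t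
    using that d(3) by (simp add: E_def max_def)
  have E_right: "E i t = G t" if "i < n" "y (Suc i) \<le> t" for i t
    using that d(4) seg[of i] by (simp add: E_def max_def)
  have E_mono: "E i s \<le> E i t" if i: "i < n" and st: "s \<le> t" "t \<le> y (Suc i)" for i s t
  proof -
    have "E i x = G (max x (y i)) - d i (max x (y i))" for x
      using d(3)[OF i] by (cases "x \<le> y i") (auto simp: E_def max_def)
    thus ?thesis using d(5)[OF i, of "max s (y i)" "max t (y i)"] st seg[OF i] by auto
  qed
  \<comment> \<open>The summand \<open>U 0\<close> joins the first falling part to the last rising part across \<open>y n = y 0 + 1\<close>.\<close>
  define U where "U i t = (if i = 0 then d 0 t + E (n - 1) t else E (i - 1) t - E i t)" for i t
  have U_sum: "(\<Sum>i<n. U i t) = G t" if t: "y 0 \<le> t" for t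
  proof -
    obtain m where m: "n = Suc m" using n by (cases n) auto
    have "(\<Sum>i<n. U i t) = U 0 t + (\<Sum>i<m. E i t - E (Suc i) t)"
      unfolding m by (simp add: sum.lessThan_Suc_shift U_def del: sum.lessThan_Suc)
    also have "(\<Sum>i<m. E i t - E (Suc i) t) = E 0 t - E m t"
      by (rule sum_lessThan_telescope')
    finally show ?thesis using t by (simp add: U_def E_def m max_def)
  qed
  have "\<exists>u. unimodal (sphere 0 1) u \<and> (\<forall>t\<in>{y 0..y n}. u (circ t) = U i t)" if i: "i < n" for i
  proof (cases "i = 0")
    case False
    define j where "j = i - 1"
    have j: "i = Suc j" "j < n" using False i by (auto simp: j_def)
    have U: "U i t = E j t - E i t" for t by (simp add: U_def j)
    have U_up: "U i t = E j t" if "t \<le> y i" for t using E_left[OF i that] by (simp add: U)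
    have U_down: "U i t = d i t" if t: "y i \<le> t" for t
    proof -
      have "E j t = G t" using E_right[OF j(2), of t] t j(1) by simp
      thus ?thesis using t by (simp add: U E_def[of i] max_def)
    qed
    have y: "y 0 \<le> y j" "y 0 \<le> y i" "y i \<le> y n" "y (Suc i) \<le> y n"
      using ymono i j by auto
    have ends: "U i (y 0) = 0" "U i (y n) = 0"
      using U_up[of "y 0"] U_down[of "y n"] E_left[OF j(2)] d(4)[OF i] y by auto
    have "continuous_on {y 0..y 0 + 1} (U i)"
      unfolding U using contE i j by (intro continuous_intros) auto
    then obtain u where u: "continuous_on (sphere 0 1) u"
        "\<And>t. t \<in> {y 0..y 0 + 1} \<Longrightarrow> u (circ t) = U i t"
      by (rule circle_function_of_loop) (use ends around in auto)
    have "unimodal (sphere 0 1) u"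
    proof (rule unimodal_circleI[of _ "y 0" "y i"])
      show "u (circ (y 0)) = 0" using u(2) ends by simp
      show "0 < u (circ (y i))"
        using u(2)[of "y i"] y around U_down[of "y i"] d(3)[OF i] posG by simp
      show "u (circ s) \<le> u (circ t)" if "y 0 \<le> s" "s \<le> t" "t \<le> y i" for s t
        using that y around u(2)[of s] u(2)[of t] U_up E_mono[OF j(2), of s t] j(1) by simp
      show "u (circ t) \<le> u (circ s)" if "y i \<le> s" "s \<le> t" "t \<le> y 0 + 1" for s t
        using that y around u(2)[of s] u(2)[of t] U_down antimonoD[OF d(2)[OF i], of s t] by simp
    qed (use u y around in auto)
    thus ?thesis using u(2) around by auto
  next
    case True
    define m where "m = n - 1"
    have m: "n = Suc m" "m < n" "Suc 0 \<le> m" using n by (auto simp: m_def)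
    have U: "U i t = d 0 t + E m t" for t by (simp add: U_def True m_def)
    have y: "y 0 < y 1" "y 1 \<le> y m" "y m < y n" using ymono[of 1 m] seg[of 0] seg[of m] m by auto
    have U_down: "U i t = d 0 t" if "t \<le> y 1" for t
      using that y E_left[OF m(2)] by (simp add: U)
    have U_up: "U i t = E m t" if "y 1 \<le> t" for t
      using that d(4)[of 0 t] m by (simp add: U)
    have Gn: "G (y n) = G (y 0)" using around by (simp add: G_def)
    have ends: "U i (y 0) = G (y 0)" "U i (y n) = G (y 0)"
      using U_down[of "y 0"] U_up[of "y n"] d(3)[of 0 "y 0"] E_right[OF m(2), of "y n"] y m Gn by auto
    have "continuous_on {y 0..y 0 + 1} (U i)"
      unfolding U using contE m
      by (intro continuous_intros continuous_on_subset[OF d(1)[of 0]]) auto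
    then obtain u where u: "continuous_on (sphere 0 1) u"
        "\<And>t. t \<in> {y 0..y 0 + 1} \<Longrightarrow> u (circ t) = U i t"
      by (rule circle_function_of_loop) (use ends around in auto)
    have turn: "u (circ t) = U i (t - 1)" if "t \<in> {y n..y n + 1}" for t
      using u(2)[of "t - 1"] that around by auto
    have "unimodal (sphere 0 1) u"
    proof (rule unimodal_circleI[of _ "y 1" "y n"])
      show "u (circ (y 1)) = 0" using u(2)[of "y 1"] U_down[of "y 1"] d(4)[of 0 "y 1"] y m around by simp
      show "0 < u (circ (y n))" using u(2)[of "y n"] ends y around posG by simp
      show "u (circ s) \<le> u (circ t)" if "y 1 \<le> s" "s \<le> t" "t \<le> y n" for s t
        using that y around u(2)[of s] u(2)[of t] U_up E_mono[OF m(2), of s t] m(1) by simp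
      show "u (circ t) \<le> u (circ s)" if "y n \<le> s" "s \<le> t" "t \<le> y 1 + 1" for s t
        using that y around turn[of s] turn[of t] U_down antimonoD[OF d(2)[of 0], of "s - 1" "t - 1"] m
        by simp
    qed (use u y around in auto)
    thus ?thesis using u(2) around by auto
  qed
  hence "\<forall>i. \<exists>u. i < n \<longrightarrow> unimodal (sphere 0 1) u \<and> (\<forall>t\<in>{y 0..y n}. u (circ t) = U i t)" by blast
  from choice[OF this] obtain u where u: "\<And>i. i < n \<Longrightarrow> unimodal (sphere 0 1) (u i)"
      "\<And>i t. i < n \<Longrightarrow> t \<in> {y 0..y n} \<Longrightarrow> u i (circ t) = U i t" by blast
  have "f z = (\<Sum>i<n. u i z)" if z: "z \<in> sphere 0 1" for z
  proof -
    obtain t where t: "y 0 \<le> t" "t < y 0 + 1" "z = circ t" using circ_surj[OF z] .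
    have "(\<Sum>i<n. u i z) = (\<Sum>i<n. U i t)" using u(2) t around by (intro sum.cong) auto
    thus ?thesis using U_sum[OF t(1)] t(3) by (simp add: G_def)
  qed
  thus ?thesis using u(1) by blast
qed

section \<open>Upper bound by greedy cutting\<close>

text \<open>The inequalities are strict, hence survive a small shift of the first point to the right.
  The shift gives the preceding interval the room that it needs to become forced-max itself.\<close>

lemma forced_chain_delay:
  fixes G N :: "real \<Rightarrow> real"
  assumes contN: "continuous_on {0..1} N" and contG: "continuous_on {0..1} G"
    and "1 \<le> n" "0 \<le> z 0" "z n \<le> 1"
    and forced: "\<forall>i<n. z i < z (Suc i) \<and> G (z i) < N (z (Suc i)) - N (z i)"
  shows "\<exists>z'. z 0 < z' 0 \<and> z' n \<le> 1 \<and>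
            (\<forall>i<n. z' i < z' (Suc i) \<and> G (z' i) < N (z' (Suc i)) - N (z' i))"
proof -
  have z01: "z 0 < z 1" using forced assms(3) by auto
  have z1: "z 1 \<le> 1" using increasing_upto[of n z 1 n] forced assms(3,5) by auto
  have "continuous_on {0..1} (\<lambda>t. G t + N t)" by (intro continuous_intros contN contG)
  moreover have "0 < N (z 1) - N (z 0) - G (z 0)" using forced assms(3) by auto
  moreover have "z 0 \<in> {0..1}" using z01 z1 assms(4) by auto
  ultimately obtain \<delta> where \<delta>: "0 < \<delta>"
    "\<And>t. t \<in> {0..1} \<Longrightarrow> dist t (z 0) < \<delta> \<Longrightarrow>
       dist (G t + N t) (G (z 0) + N (z 0)) < N (z 1) - N (z 0) - G (z 0)"
    unfolding continuous_on_iff by meson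
  define t where "t = min (z 0 + \<delta> / 2) ((z 0 + z 1) / 2)"
  have t: "z 0 < t" "t < z 1" "dist t (z 0) < \<delta>"
    using z01 \<delta>(1) by (auto simp: t_def dist_real_def min_less_iff_disj)
  hence "G t < N (z 1) - N t" using \<delta>(2)[of t] z1 assms(4) by (auto simp: dist_real_def abs_less_iff)
  thus ?thesis using t forced assms(3,5) by (intro exI[of _ "z(0 := t)"]) auto
qed

text \<open>Greedy cutting: let the next cut point be the last one before which \<open>G\<close> has descended by at
  most its value at the present cut point. Either the end is reached within \<open>n\<close> segments, or each
  segment, prolonged slightly, has descent exceeding its initial value. A single segment that
  reaches the end may be subdivided at will: cutting at \<open>t\<close> lowers the remaining descent at least
  as much as it lowers \<open>G\<close>.\<close>

lemma greedy_dichotomy: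
  fixes G N :: "real \<Rightarrow> real"
  assumes dom: "dominates_drops N G {0..1}" and cont: "continuous_on {0..1} G"
    and pos: "\<And>t. t \<in> {0..1} \<Longrightarrow> 0 < G t"
    and "1 \<le> n" "0 \<le> x" "x < 1"
  shows "(\<exists>y. y 0 = x \<and> y n = 1 \<and>
            (\<forall>i<n. y i < y (Suc i) \<and> N (y (Suc i)) - N (y i) \<le> G (y i))) \<or>
         (\<exists>z. z 0 = x \<and> z n \<le> 1 \<and>
            (\<forall>i<n. z i < z (Suc i) \<and> G (z i) < N (z (Suc i)) - N (z i)))"
    (is "?split n x \<or> ?forced n x")
  using assms(4-6)
proof (induction n arbitrary: x rule: dec_induct)
  have contN: "continuous_on {0..1} N" using dom by (simp add: dominates_drops_def)
  have drop: "max 0 (G s - G t) \<le> N t - N s" if "0 \<le> s" "s \<le> t" "t \<le> 1" for s t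
    using dom that by (auto simp: dominates_drops_def)
  have one_segment: "?split n x" if n: "1 \<le> n" and x: "0 \<le> x" "x < 1" and le: "N 1 - N x \<le> G x" for n x
  proof -
    define y where "y i = x + real i / real n * (1 - x)" for i
    have step: "y i < y (Suc i) \<and> x \<le> y i \<and> y (Suc i) \<le> 1" if "i < n" for i
    proof -
      have "real i / real n < real (Suc i) / real n" "real (Suc i) / real n \<le> 1"
        using that by (auto simp: divide_simps)
      thus ?thesis using x mult_right_mono[of "real (Suc i) / real n" 1 "1 - x"]
        mult_strict_right_mono[of "real i / real n" "real (Suc i) / real n" "1 - x"]
        by (simp add: y_def)
    qed
    have "N (y (Suc i)) - N (y i) \<le> G (y i)" if "i < n" for i
      using drop[of x "y i"] drop[of "y (Suc i)" 1] step[OF that] x le by auto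
    moreover have "y 0 = x" "y n = 1" using n by (auto simp: y_def)
    ultimately show ?thesis using step by (intro exI[of _ y]) auto
  qed
  {
    case base
    show ?case
    proof (cases "N 1 - N x \<le> G x")
      case True
      thus ?thesis using one_segment base by blast
    next
      case False
      thus ?thesis using base by (intro disjI2 exI[of _ "case_nat x (\<lambda>_. 1)"]) auto
    qed
  next
    case (step n)
    show ?case
    proof (cases "N 1 - N x \<le> G x")
      case True
      thus ?thesis using one_segment[of "Suc n" x] step.prems by simp
    next
      case False
      define C where "C = {t \<in> {x..1}. N t \<le> N x + G x}"
      have contx: "continuous_on {x..1} N"
        using step.prems by (intro continuous_on_subset[OF contN]) auto
      have "closed (N -` {..N x + G x} \<inter> {x..1})"
        using contx continuous_on_closed_vimage[OF closed_atLeastAtMost] closed_atMost by blast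
      moreover have C: "C = N -` {..N x + G x} \<inter> {x..1}" by (auto simp: C_def)
      ultimately have "compact C"
        by (metis bounded_Int bounded_closed_interval compact_eq_bounded_closed)
      moreover have "x \<in> C" using pos[of x] step.prems by (auto simp: C_def)
      ultimately obtain y where y: "y \<in> C" "\<And>t. t \<in> C \<Longrightarrow> t \<le> y"
        using compact_attains_sup[of C] by blast
      have y1: "y < 1" using y(1) False by (cases "y = 1") (auto simp: C_def)
      have beyond: "N x + G x < N t" if "y < t" "t \<le> 1" for t
        using y(1) y(2)[of t] that by (auto simp: C_def not_le[symmetric])
      obtain t where t: "x \<le> t" "t \<le> 1" "N t = N x + G x"
        using IVT'[of N x "N x + G x" 1] contx step.prems False pos[of x] by auto
      have "x < y"
      proof -
        have "t \<noteq> x" using t(3) pos[of x] step.prems by auto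
        moreover have "t \<le> y" using y(2)[of t] t by (simp add: C_def)
        ultimately show ?thesis using t(1) by linarith
      qed
      have "?split n y \<or> ?forced n y" using step.IH[of y] \<open>x < y\<close> y1 step.prems by simp
      thus ?thesis
      proof
        assume "?split n y"
        then obtain w where w: "w 0 = y" "w n = 1"
          "\<forall>i<n. w i < w (Suc i) \<and> N (w (Suc i)) - N (w i) \<le> G (w i)" by blast
        have "N y - N x \<le> G x" using y(1) by (simp add: C_def)
        hence "?split (Suc n) x" using w \<open>x < y\<close>
          by (intro exI[of _ "case_nat x w"]) (auto simp: less_Suc_eq_0_disj)
        thus ?thesis ..
      next
        assume "?forced n y"
        then obtain z where z: "z 0 = y" "z n \<le> 1"
          "\<forall>i<n. z i < z (Suc i) \<and> G (z i) < N (z (Suc i)) - N (z i)" by blast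
        obtain z' where z': "y < z' 0" "z' n \<le> 1"
          "\<forall>i<n. z' i < z' (Suc i) \<and> G (z' i) < N (z' (Suc i)) - N (z' i)"
          using forced_chain_delay[OF contN cont, of n z] z step.hyps step.prems \<open>x < y\<close> by auto
        have "z' 0 \<le> 1" using increasing_upto[of n z' 0 n] z' by auto
        hence "G x < N (z' 0) - N x" using beyond[of "z' 0"] z' by auto
        hence "?forced (Suc n) x" using z' \<open>x < y\<close>
          by (intro exI[of _ "case_nat x z'"]) (auto simp: less_Suc_eq_0_disj)
        thus ?thesis ..
      qed
    qed
  }
qed


lemma extension_inside: "0 \<le> t \<Longrightarrow> t \<le> 1 \<Longrightarrow> extension g t = g t"
  by (auto simp: extension_def)

lemma forced_maxI:
  assumes c: "(k, c) \<in> chains {s<..<t}" and v: "v < (\<Sum>i<k. max 0 (g (c i) - g (c (Suc i))))" "0 \<le> v"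
    and st: "0 \<le> s" "t \<le> 1" and xy: "x < y" "{s<..<t} \<subseteq> einterval x y" "einterval x y \<subseteq> {..1}"
    and start: "(if x = -\<infinity> then 0 else extension g (real_of_ereal x)) \<le> v"
  shows "forced_max {..1} (extension g) x y"
proof -
  have inside: "extension g (c i) = g (c i)" if "i \<le> k" for i
    using c that st by (intro extension_inside) (force simp: chains_def)+
  have "ennreal (if x = -\<infinity> then 0 else extension g (real_of_ereal x)) \<le> ennreal v"
    using start by (rule ennreal_leI)
  also have "\<dots> < ennreal (\<Sum>i<k. max 0 (g (c i) - g (c (Suc i))))"
    using v by (simp add: ennreal_lessI)
  also have "(\<Sum>i<k. max 0 (g (c i) - g (c (Suc i))))
      = (\<Sum>i<k. max 0 (extension g (c i) - extension g (c (Suc i))))"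
    by (intro sum.cong) (auto simp: inside)
  also have "ennreal \<dots> \<le> neg_variation (extension g) (einterval x y)"
  proof -
    have "(k, c) \<in> chains (einterval x y)" using c xy(2) by (auto simp: chains_def)
    thus ?thesis unfolding neg_variation_def by (rule SUP_upper2) auto
  qed
  finally show ?thesis unfolding forced_max_def using xy by simp
qed

text \<open>The first cut point is the end of the initial stretch on which the loop does not descend. If
  the greedy procedure did not get around in \<open>n\<close> segments, then its \<open>n\<close> intervals together with the
  interval from \<open>-\<infinity>\<close> to a point slightly after the first cut point would be \<open>n + 1\<close> disjoint
  forced-max intervals. The last segment is prolonged over the initial stretch, where nothing is
  added to the descent, and thereby closes the circle.\<close>

lemma unimodal_decomposition_of_max_forced:
  fixes f :: "complex \<Rightarrow> real"
  assumes f: "continuous_on (sphere 0 1) f" "\<And>z. z \<in> sphere 0 1 \<Longrightarrow> 0 < f z"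
    and bv: "circle_bounded_variation f" and a: "a \<in> sphere 0 1" and n: "2 \<le> n"
    and max: "max_forced {..1} (extension (loop_plus f a)) \<le> enat n"
  shows "\<exists>u :: nat \<Rightarrow> complex \<Rightarrow> real. (\<forall>i<n. unimodal (sphere 0 1) (u i)) \<and>
           (\<forall>z\<in>sphere 0 1. f z = (\<Sum>i<n. u i z))"
proof -
  obtain \<theta> where \<theta>: "0 \<le> \<theta>" "\<theta> < 0 + 1" "a = circ \<theta>" using circ_surj[OF a] .
  define F where "F t = f (circ t)" for t
  define G where "G = loop_plus f a"
  have G: "G t = F (t + \<theta>)" for t
    by (simp add: G_def F_def loop_plus_def \<theta>(3) circ_add flip: circ_def)
      (simp add: mult.commute)
  have F_periodic: "F (t + 1) = F t" for t by (simp add: F_def)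
  have contF: "continuous_on A F" for A
    unfolding F_def by (rule continuous_on_compose2[OF f(1) continuous_on_circ]) auto
  have contG: "continuous_on A G" for A
    unfolding G by (rule continuous_on_compose2[OF contF]) (auto intro!: continuous_intros)
  have posG: "0 < G t" for t using f(2) by (simp add: G F_def)
  obtain B where B: "\<And>s t v. 0 \<le> s \<Longrightarrow> t \<le> 1 \<Longrightarrow> drop_sum F s t v \<Longrightarrow> v \<le> B"
    using bounded_drop_sums[of F 0 1] bv
    unfolding circle_bounded_variation_def F_def circ_def by auto
  have "v \<le> B + B" if v: "drop_sum G 0 1 v" for v
  proof -
    \<comment> \<open>The loop from \<open>circ \<theta>\<close> runs through the parameters from \<open>\<theta>\<close> to \<open>1\<close> and then from \<open>0\<close> to \<open>\<theta>\<close>.\<close>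
    obtain v1 v2 where w: "drop_sum G 0 (1 - \<theta>) v1" "drop_sum G (1 - \<theta>) 1 v2" "v \<le> v1 + v2"
      using drop_sum_split[OF v, of "1 - \<theta>"] \<theta> by auto
    have "drop_sum F (0 + \<theta>) (1 - \<theta> + \<theta>) v1" by (rule drop_sum_translate[OF w(1)]) (simp add: G)
    moreover have "drop_sum F (1 - \<theta> + (\<theta> - 1)) (1 + (\<theta> - 1)) v2"
      by (rule drop_sum_translate[OF w(2)]) (use F_periodic in \<open>simp add: G flip: F_periodic[of "_ + (\<theta> - 1)"]\<close>)
    ultimately show ?thesis using B[of \<theta> 1 v1] B[of 0 \<theta> v2] \<theta> w(3) by simp
  qed
  then obtain N where dom: "dominates_drops N G {0..1}"
    and tight: "\<And>s t v. 0 \<le> s \<Longrightarrow> s < t \<Longrightarrow> t \<le> 1 \<Longrightarrow> v < N t - N s \<Longrightarrow>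
       \<exists>(k, c)\<in>chains {s<..<t}. v < (\<Sum>i<k. max 0 (G (c i) - G (c (Suc i))))"
    using continuous_negative_variation[OF _ contG, of 0 1 "B + B"] by auto
  have contN: "continuous_on {0..1} N" using dom by (simp add: dominates_drops_def)
  have drop: "max 0 (G s - G t) \<le> N t - N s" if "0 \<le> s" "s \<le> t" "t \<le> 1" for s t
    using dom that by (auto simp: dominates_drops_def)
  obtain m where m: "0 \<le> m" "m \<le> 1" "N m = N 0" "\<And>t. m < t \<Longrightarrow> t \<le> 1 \<Longrightarrow> N 0 < N t"
  proof -
    have "closed (N -` {..N 0} \<inter> {0..1})"
      using contN continuous_on_closed_vimage[OF closed_atLeastAtMost] closed_atMost by blast
    hence "compact (N -` {..N 0} \<inter> {0..1})"
      by (metis bounded_Int bounded_closed_interval compact_eq_bounded_closed)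
    moreover have "0 \<in> N -` {..N 0} \<inter> {0..1}" by simp
    ultimately obtain m where m: "m \<in> N -` {..N 0} \<inter> {0..1}"
        "\<And>t. t \<in> N -` {..N 0} \<inter> {0..1} \<Longrightarrow> t \<le> m"
      using compact_attains_sup[of "N -` {..N 0} \<inter> {0..1}"] by blast
    show thesis
    proof (rule that[of m])
      show "N m = N 0" using m(1) drop[of 0 m] by auto
      show "N 0 < N t" if "m < t" "t \<le> 1" for t
        using m(1) m(2)[of t] that by (auto simp: not_le[symmetric])
    qed (use m in auto)
  qed
  \<comment> \<open>If the loop never descends, it is constant and any starting point will do; \<open>0\<close> keeps \<open>x < 1\<close>.\<close>
  define x where "x = (if m = 1 then 0 else m)"
  have x: "0 \<le> x" "x < 1" "N x = N 0" using m by (auto simp: x_def)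
  have not_forced: False
    if z: "z 0 = x" "z n \<le> 1" "\<forall>i<n. z i < z (Suc i) \<and> G (z i) < N (z (Suc i)) - N (z i)" for z
  proof -
    obtain w where w: "x < w 0" "w n \<le> 1"
        and step: "\<And>i. i < n \<Longrightarrow> w i < w (Suc i) \<and> G (w i) < N (w (Suc i)) - N (w i)"
      using forced_chain_delay[OF contN contG, of n z] z x n by auto
    have w_mono: "w i \<le> w j" if "i \<le> j" "j \<le> n" for i j
      using increasing_upto[of n w i j] step that by blast
    have w01: "0 \<le> w i" "w i \<le> 1" if "i \<le> n" for i
      using w_mono[of 0 i] w_mono[of i n] that w x by auto
    have "m \<noteq> 1"
    proof
      assume "m = 1"
      hence "N (w 1) \<le> N (w 0)"
        using drop[of "w 1" 1] drop[of 0 "w 0"] w01[of 0] w01[of 1] n m(3) by auto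
      thus False using step[of 0] posG[of "w 0"] n by auto
    qed
    hence first: "0 < N (w 0) - N 0" using m(4)[of "w 0"] w w01[of 0] by (simp add: x_def)
    define I where "I i = (case i of 0 \<Rightarrow> -\<infinity> | Suc j \<Rightarrow> ereal (w j), ereal (w i))" for i
    have I_forced: "forced_max {..1} (extension G) (fst (I i)) (snd (I i))" if i: "i \<le> n" for i
    proof (cases i)
      case 0
      obtain k c where c: "(k, c) \<in> chains {0<..<w 0}" "0 < (\<Sum>i<k. max 0 (G (c i) - G (c (Suc i))))"
        using tight[of 0 "w 0" 0] first w w01[of 0] x by auto
      show ?thesis unfolding I_def 0
        by (rule forced_maxI[OF c]) (use w01[of 0] in \<open>auto simp: einterval_iff\<close>)
    next
      case (Suc j)
      hence j: "j < n" using i by simp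
      obtain k c where c: "(k, c) \<in> chains {w j<..<w (Suc j)}"
          "G (w j) < (\<Sum>i<k. max 0 (G (c i) - G (c (Suc i))))"
        using tight[of "w j" "w (Suc j)" "G (w j)"] step[OF j] w01[of j] w01[of "Suc j"] j by auto
      show ?thesis unfolding I_def Suc
        by (rule forced_maxI[OF c])
          (use w01[of j] w01[of "Suc j"] step[OF j] posG[of "w j"] j in \<open>auto simp: extension_inside\<close>)
    qed
    have I_sep: "einterval (fst (I i)) (snd (I i)) \<inter> einterval (fst (I j)) (snd (I j)) = {}"
      if ij: "i < j" "j \<le> n" for i j
    proof -
      obtain j' where "j = Suc j'" using ij by (cases j) auto
      thus ?thesis using w_mono[of i j'] ij by (auto simp: I_def einterval_iff)
    qed
    have I_ne: "einterval (fst (I i)) (snd (I i)) \<noteq> {}" if "i \<le> n" for i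
      using I_forced[OF that] einterval_nonempty unfolding forced_max_def by blast
    have inj: "inj_on I {..n}"
      by (rule linorder_inj_onI) (use I_sep I_ne in fastforce)+
    have "enat (card (I ` {..n})) \<le> max_forced {..1} (extension G)"
      unfolding max_forced_def
    proof (rule SUP_upper, intro CollectI conjI)
      show "\<forall>(x, y)\<in>I ` {..n}. forced_max {..1} (extension G) x y"
        unfolding case_prod_beta using I_forced by blast
      show "disjoint_family_on (\<lambda>(x, y). einterval x y) (I ` {..n})"
        unfolding disjoint_family_on_def case_prod_beta
      proof (intro ballI impI)
        fix p q assume "p \<in> I ` {..n}" "q \<in> I ` {..n}" "p \<noteq> q"
        then obtain i j where ij: "p = I i" "q = I j" "i \<le> n" "j \<le> n" "i \<noteq> j" by auto
        show "einterval (fst p) (snd p) \<inter> einterval (fst q) (snd q) = {}"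
          using I_sep[of i j] I_sep[of j i] ij by (cases "i < j") (auto simp: Int_commute)
      qed
    qed simp
    also have "\<dots> \<le> enat n" using max by (simp add: G_def)
    finally show False using card_image[OF inj] by simp
  qed
  obtain y where y: "y 0 = x" "y n = 1"
      "\<And>i. i < n \<Longrightarrow> y i < y (Suc i) \<and> N (y (Suc i)) - N (y i) \<le> G (y i)"
    using greedy_dichotomy[OF dom contG posG _ x(1,2), of n] n not_forced by auto
  have y_mono: "y i \<le> y j" if "i \<le> j" "j \<le> n" for i j
    using increasing_upto[of n y i j] y(3) that by blast
  define Y where "Y i = \<theta> + (if i = n then 1 + x else y i)" for i
  \<comment> \<open>The negative variation is constant on the prolongation of the last segment beyond \<open>1\<close>.\<close>
  define H where "H t = N (min (t - \<theta>) 1)" for t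
  show ?thesis
  proof (rule circle_sum_of_unimodal[OF f n])
    show "Y n = Y 0 + 1" using n y by (simp add: Y_def)
    have Y: "{Y 0..Y n} = {\<theta> + x..\<theta> + x + 1}" using n y by (simp add: Y_def add_ac)
    have "continuous_on {\<theta> + x..\<theta> + x + 1} H"
      unfolding H_def by (rule continuous_on_compose2[OF contN]) (use x in \<open>auto intro!: continuous_intros\<close>)
    moreover have "max 0 (F s - F t) \<le> H t - H s"
      if st: "\<theta> + x \<le> s" "s \<le> t" "t \<le> \<theta> + x + 1" for s t
    proof -
      have early: "max 0 (F p - F q) \<le> H q - H p" if "\<theta> + x \<le> p" "p \<le> q" "q \<le> \<theta> + 1" for p q
        using drop[of "p - \<theta>" "q - \<theta>"] that x by (simp add: G H_def)
      have late: "max 0 (F p - F q) \<le> H q - H p" if "\<theta> + 1 \<le> p" "p \<le> q" "q \<le> \<theta> + x + 1" for p q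
        using drop[of "p - \<theta> - 1" "q - \<theta> - 1"] drop[of 0 "p - \<theta> - 1"] drop[of "q - \<theta> - 1" x] that x
          F_periodic[of "p - 1"] F_periodic[of "q - 1"] by (simp add: G H_def)
      consider "t \<le> \<theta> + 1" | "\<theta> + 1 \<le> s" | "s \<le> \<theta> + 1" "\<theta> + 1 \<le> t" by linarith
      thus ?thesis
      proof cases
        case 3
        thus ?thesis using early[of s "\<theta> + 1"] late[of "\<theta> + 1" t] st by auto
      qed (use early late st in auto)
    qed
    ultimately show "dominates_drops H (\<lambda>t. f (circ t)) {Y 0..Y n}"
      unfolding dominates_drops_def Y F_def by auto
    show "Y i < Y (Suc i) \<and> H (Y (Suc i)) - H (Y i) \<le> f (circ (Y i))" if i: "i < n" for i
    proof -
      have "f (circ (Y i)) = G (y i)" using i by (simp add: Y_def G F_def add_ac)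
      moreover have "H (Y i) = N (y i)" using i y_mono[of i n] y(2) by (simp add: H_def Y_def)
      moreover have "H (Y (Suc i)) = N (y (Suc i))"
        using i y_mono[of "Suc i" n] y(2) x by (auto simp: H_def Y_def)
      moreover have "Y i < Y (Suc i)"
        using y(2) y(3)[OF i] i x by (cases "Suc i = n") (auto simp: Y_def)
      ultimately show ?thesis using y(3)[OF i] by simp
    qed
  qed
qed

section \<open>Lower bound by counting peaks\<close>

text \<open>Without a strict peak along the chain, the values first fall and then rise, so the total
  descent is a single fall from the initial value to a value that is at least \<open>0\<close>.\<close>

lemma chain_drops_le_start:
  fixes F :: "real \<Rightarrow> real"
  assumes "strict_mono_on {..k} c" and "\<And>i. i \<le> k \<Longrightarrow> 0 \<le> F (c i)"
    and no_peak: "\<And>i j l. i < j \<Longrightarrow> j < l \<Longrightarrow> l \<le> k \<Longrightarrow> F (c i) < F (c j) \<Longrightarrow> F (c j) \<le> F (c l)"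
  shows "(\<Sum>i<k. max 0 (F (c i) - F (c (Suc i)))) \<le> F (c 0)"
  using assms
proof (induction k arbitrary: c)
  case (Suc k)
  show ?case
  proof (cases "F (c 0) < F (c 1)")
    case False
    have "(\<Sum>i<k. max 0 (F (c (Suc i)) - F (c (Suc (Suc i))))) \<le> F (c (Suc 0))"
    proof (rule Suc.IH[of "\<lambda>i. c (Suc i)"])
      show "strict_mono_on {..k} (\<lambda>i. c (Suc i))"
        using Suc.prems(1) by (auto simp: strict_mono_on_def)
      show "F (c (Suc j)) \<le> F (c (Suc l))"
        if "i < j" "j < l" "l \<le> k" "F (c (Suc i)) < F (c (Suc j))" for i j l
        using Suc.prems(3)[of "Suc i" "Suc j" "Suc l"] that by simp
    qed (use Suc.prems in auto)
    thus ?thesis using False by (simp add: sum.lessThan_Suc_shift del: sum.lessThan_Suc)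
  next
    case True
    have rise: "F (c 0) < F (c j) \<and> F (c 1) \<le> F (c j)" if "1 \<le> j" "j \<le> Suc k" for j
      using that True Suc.prems(3)[of 0 1 j] by (cases "j = 1") auto
    have "max 0 (F (c i) - F (c (Suc i))) = 0" if "i < Suc k" for i
      using that True Suc.prems(3)[of 0 i "Suc i"] rise[of i] by (cases "i = 0") auto
    hence "(\<Sum>i<Suc k. max 0 (F (c i) - F (c (Suc i)))) = 0" by (intro sum.neutral) auto
    thus ?thesis using Suc.prems(2)[of 0] by simp
  qed
qed simp

text \<open>The left end point \<open>x\<close> is allowed as the foot \<open>p\<close> of the peak, because the definition of
  forced-max compares with the value at \<open>x\<close>; all points are before \<open>y\<close>, so that peaks in
  disjoint intervals do not overlap.\<close>

definition peak_between :: "(real \<Rightarrow> real) \<Rightarrow> ereal \<Rightarrow> ereal \<Rightarrow> bool" where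
  "peak_between h x y \<longleftrightarrow>
     (\<exists>p q r. x \<le> ereal p \<and> p < q \<and> q < r \<and> ereal r < y \<and> h p < h q \<and> h r < h q)"

text \<open>Total descent is subadditive while the values at \<open>x\<close> add up, so if \<open>G\<close> descends by more than
  its value at \<open>x\<close>, the same holds for one of the summands, which then has a strict peak.\<close>

lemma forced_max_peak:
  fixes U :: "nat \<Rightarrow> real \<Rightarrow> real"
  assumes forced: "forced_max {..1} (extension G) (ereal x) y" and x: "0 \<le> x"
    and sum: "\<And>t. 0 \<le> t \<Longrightarrow> t \<le> 1 \<Longrightarrow> G t = (\<Sum>i<n. U i t)"
    and nonneg: "\<And>i t. i < n \<Longrightarrow> 0 \<le> U i t"
  shows "\<exists>i<n. peak_between (U i) (ereal x) y"
proof (rule ccontr)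
  assume no: "\<not> ?thesis"
  have xy: "ereal x < y" "einterval x y \<subseteq> {..1}"
    and var: "ennreal (extension G x) < neg_variation (extension G) (einterval x y)"
    using forced by (auto simp: forced_max_def)
  obtain t where "t \<in> einterval x y" using einterval_nonempty[OF xy(1)] by blast
  hence x1: "x < 1" using xy(2) by (force simp: einterval_iff)
  obtain k c where c: "(k, c) \<in> chains (einterval x y)"
    and gt: "ennreal (extension G x) <
      ennreal (\<Sum>i<k. max 0 (extension G (c i) - extension G (c (Suc i))))"
    using var unfolding neg_variation_def less_SUP_iff by auto
  \<comment> \<open>Prepending \<open>x\<close> to the chain allows a comparison with the values at \<open>x\<close>.\<close>
  define c' where "c' = case_nat x c"
  have c_in: "x < c i" "ereal (c i) < y" "c i \<le> 1" if "i \<le> k" for i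
  proof -
    have "c i \<in> einterval x y" using c that by (auto simp: chains_def)
    thus "x < c i" "ereal (c i) < y" "c i \<le> 1" using xy(2) by (auto simp: einterval_iff)
  qed
  have c': "strict_mono_on {..Suc k} c'" "c' 0 = x"
    using c c_in(1) by (auto simp: c'_def chains_def strict_mono_on_def split: nat.splits)
  have range: "x \<le> c' i" "ereal (c' i) < y" "0 \<le> c' i" "c' i \<le> 1" if "i \<le> Suc k" for i
    using that c_in[of "i - 1"] x x1 xy by (auto simp: c'_def split: nat.splits)
  have "(\<Sum>j<Suc k. max 0 (U i (c' j) - U i (c' (Suc j)))) \<le> U i (c' 0)" if i: "i < n" for i
  proof (rule chain_drops_le_start[OF c'(1)])
    fix p q r assume pqr: "p < q" "q < r" "r \<le> Suc k" and rise: "U i (c' p) < U i (c' q)"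
    show "U i (c' q) \<le> U i (c' r)"
    proof (rule ccontr)
      assume "\<not> ?thesis"
      moreover have "c' p < c' q" "c' q < c' r" using c'(1) pqr by (auto simp: strict_mono_on_def)
      ultimately have "peak_between (U i) (ereal x) y"
        unfolding peak_between_def using rise range pqr
        by (intro exI[of _ "c' p"] exI[of _ "c' q"] exI[of _ "c' r"]) auto
      thus False using no i by blast
    qed
  qed (use nonneg i in auto)
  hence "(\<Sum>i<n. \<Sum>j<Suc k. max 0 (U i (c' j) - U i (c' (Suc j)))) \<le> (\<Sum>i<n. U i x)"
    using c'(2) by (intro sum_mono) auto
  also have "\<dots> = extension G x" using sum[of x] x x1 by (simp add: extension_inside)
  finally have le: "(\<Sum>j<Suc k. \<Sum>i<n. max 0 (U i (c' j) - U i (c' (Suc j)))) \<le> extension G x"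
    by (subst sum.swap)
  have split: "max 0 (extension G s - extension G t) \<le> (\<Sum>i<n. max 0 (U i s - U i t))"
    if "0 \<le> s" "s \<le> 1" "0 \<le> t" "t \<le> 1" for s t
  proof -
    have "G s - G t = (\<Sum>i<n. U i s - U i t)" using sum that by (simp add: sum_subtractf)
    also have "\<dots> \<le> (\<Sum>i<n. max 0 (U i s - U i t))" by (intro sum_mono) auto
    finally show ?thesis using that by (simp add: extension_inside sum_nonneg)
  qed
  have "(\<Sum>j<k. max 0 (extension G (c j) - extension G (c (Suc j))))
      \<le> (\<Sum>j<k. \<Sum>i<n. max 0 (U i (c j) - U i (c (Suc j))))"
  proof (intro sum_mono split)
    fix j assume "j \<in> {..<k}"
    thus "0 \<le> c j" "c j \<le> 1" "0 \<le> c (Suc j)" "c (Suc j) \<le> 1"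
      using c_in[of j] c_in[of "Suc j"] x by auto
  qed
  also have "\<dots> \<le> (\<Sum>j<Suc k. \<Sum>i<n. max 0 (U i (c' j) - U i (c' (Suc j))))"
    by (simp add: sum.lessThan_Suc_shift c'_def sum_nonneg del: sum.lessThan_Suc)
  also note le
  finally show False using gt by (simp add: ennreal_leI leD)
qed

text \<open>Two disjoint peaks within one turn have feet that separate the lower summit from the other
  one on both sides; which of the feet are used depends on which summit is lower.\<close>

lemma unimodal_circle_one_peak:
  fixes u :: "complex \<Rightarrow> real"
  assumes u: "unimodal (sphere 0 1) u" and bounds: "0 \<le> x" "y' \<le> 1" and sep: "y \<le> x'"
    and peaks: "peak_between (\<lambda>t. u (circ (t + \<theta>))) x y"
      "peak_between (\<lambda>t. u (circ (t + \<theta>))) x' y'"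
  shows False
proof -
  define h where "h t = u (circ (t + \<theta>))" for t
  obtain p q r where 1: "x \<le> ereal p" "p < q" "q < r" "ereal r < y" "h p < h q" "h r < h q"
    using peaks(1) unfolding peak_between_def h_def by blast
  obtain p' q' r' where 2: "x' \<le> ereal p'" "p' < q'" "q' < r'" "ereal r' < y'" "h p' < h q'" "h r' < h q'"
    using peaks(2) unfolding peak_between_def h_def by blast
  have "0 \<le> p" "r' < 1" "r < p'"
    using 1 2 bounds sep by (metis ereal_less_eq(3) order_trans zero_ereal_def,
      metis ereal_less(3) less_le_trans one_ereal_def, meson ereal_less(2) less_le_trans ereal_less_eq(3) not_le)
  show False
  proof (cases "h q \<le> h q'")
    case True
    show False
      by (rule unimodal_circle_no_two_valleys[OF u, of "p + \<theta>" "q + \<theta>" "r + \<theta>" "q' + \<theta>"])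
        (use 1 2 True \<open>0 \<le> p\<close> \<open>r' < 1\<close> \<open>r < p'\<close> in \<open>auto simp: h_def\<close>)
  next
    case False
    have "h (r' - 1) = h r'" using circ_diff_1[of "r' + \<theta>"] by (simp add: h_def algebra_simps)
    show False
      by (rule unimodal_circle_no_two_valleys[OF u, of "r' - 1 + \<theta>" "q + \<theta>" "p' + \<theta>" "q' + \<theta>"])
        (use 1 2 False \<open>0 \<le> p\<close> \<open>r' < 1\<close> \<open>r < p'\<close> \<open>h (r' - 1) = h r'\<close> in \<open>auto simp: h_def\<close>)
  qed
qed

text \<open>The starting point is itself a summit, and the two feet of any peak within the turn separate
  it from the summit of that peak.\<close>

lemma unimodal_circle_no_peak_from_max:
  fixes u :: "complex \<Rightarrow> real"
  assumes u: "unimodal (sphere 0 1) u" and bounds: "0 \<le> x" "y \<le> 1"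
    and top: "\<And>z. z \<in> sphere 0 1 \<Longrightarrow> u z \<le> u (circ \<theta>)"
  shows "\<not> peak_between (\<lambda>t. u (circ (t + \<theta>))) x y"
proof
  define h where "h t = u (circ (t + \<theta>))" for t
  assume "peak_between (\<lambda>t. u (circ (t + \<theta>))) x y"
  then obtain p q r where 1: "x \<le> ereal p" "p < q" "q < r" "ereal r < y" "h p < h q" "h r < h q"
    unfolding peak_between_def h_def by blast
  have "0 \<le> p" "r < 1"
    using 1 bounds by (metis ereal_less_eq(3) order_trans zero_ereal_def,
      metis ereal_less(3) less_le_trans one_ereal_def)
  have h0: "h t \<le> h 0" for t using top by (simp add: h_def)
  hence "p \<noteq> 0" using 1(5) h0[of q] by (metis not_le)
  have "h (r - 1) = h r" using circ_diff_1[of "r + \<theta>"] by (simp add: h_def algebra_simps)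
  show False
    by (rule unimodal_circle_no_two_valleys[OF u, of "r - 1 + \<theta>" "0 + \<theta>" "p + \<theta>" "q + \<theta>"])
      (use 1 \<open>0 \<le> p\<close> \<open>r < 1\<close> \<open>p \<noteq> 0\<close> \<open>h (r - 1) = h r\<close> h0[of q] in \<open>auto simp: h_def\<close>)
qed

lemma extension_mono_left:
  assumes "0 \<le> g 0" "s \<le> t" "t \<le> 0"
  shows "extension g s \<le> extension g t"
  using assms mult_right_mono[of "s + 1" "t + 1" "g 0"] by (auto simp: extension_def)

text \<open>The extension does not descend to the left of \<open>0\<close>.\<close>

lemma forced_max_crosses_0:
  assumes "0 \<le> g 0" and forced: "forced_max J (extension g) x y"
  shows "0 < y"
proof (rule ccontr)
  assume y: "\<not> 0 < y"
  have "(\<Sum>i<k. max 0 (extension g (c i) - extension g (c (Suc i)))) = 0"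
    if c: "(k, c) \<in> chains (einterval x y)" for k c
  proof (rule sum.neutral, intro ballI)
    fix i assume "i \<in> {..<k}"
    hence "c i < c (Suc i)" "ereal (c (Suc i)) < y"
      using c by (auto simp: chains_def strict_mono_on_def einterval_iff image_subset_iff)
    moreover from this(2) have "c (Suc i) \<le> 0"
      using y by (metis ereal_less(2) less_imp_le less_le_trans not_le order_less_imp_not_less zero_ereal_def ereal_less_eq(3))
    ultimately show "max 0 (extension g (c i) - extension g (c (Suc i))) = 0"
      using extension_mono_left[of g "c i" "c (Suc i)"] assms(1) by simp
  qed
  hence "neg_variation (extension g) (einterval x y) \<le> 0"
    unfolding neg_variation_def by (intro SUP_least) auto
  thus False using forced by (simp add: forced_max_def)
qed

lemma einterval_disjoint_order:
  assumes "x < y" "x' < y'" "einterval x y \<inter> einterval x' y' = {}"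
  shows "y \<le> x' \<or> y' \<le> x"
proof (rule ccontr)
  assume "\<not> ?thesis"
  hence "max x x' < min y y'" using assms by auto
  then obtain t where "t \<in> einterval (max x x') (min y y')" using einterval_nonempty by blast
  thus False using assms(3) by (auto simp: einterval_iff)
qed


lemma einterval_subset_atMost:
  assumes "x < y" "einterval x y \<subseteq> {..b}"
  shows "y \<le> ereal b"
proof (rule ccontr)
  assume "\<not> ?thesis"
  hence "max x (ereal b) < y" using assms(1) by auto
  then obtain t where "t \<in> einterval (max x (ereal b)) y" using einterval_nonempty by blast
  thus False using assms(2) by (force simp: einterval_iff)
qed

text \<open>Start at a maximum of \<open>u 0\<close>. Each forced-max interval that begins at or after \<open>0\<close> contains a
  peak of some \<open>u i\<close>; here \<open>i \<noteq> 0\<close>, and different intervals have different \<open>i\<close>. The intervals that begin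
  before \<open>0\<close> all contain small positive numbers, so there is at most one among disjoint ones. It
  takes the place of the index \<open>0\<close>.\<close>

lemma max_forced_le_unimodal_count:
  fixes f :: "complex \<Rightarrow> real"
  assumes n: "1 \<le> n" and u: "\<And>i. i < n \<Longrightarrow> unimodal (sphere 0 1) (u i)"
    and f: "\<And>z. z \<in> sphere 0 1 \<Longrightarrow> f z = (\<Sum>i<n. u i z)"
  shows "\<exists>a\<in>sphere 0 1. max_forced {..1} (extension (loop_plus f a)) \<le> enat n"
proof -
  have nonneg: "0 \<le> u i (circ t)" if "i < n" for i t
    using u[OF that] circ_in_sphere unfolding unimodal_def by blast
  have "continuous_on (sphere 0 1) (u 0)" using u[of 0] n by (simp add: unimodal_def)
  then obtain a where a: "a \<in> sphere 0 1" "\<And>z. z \<in> sphere 0 1 \<Longrightarrow> u 0 z \<le> u 0 a"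
    using continuous_attains_sup[OF compact_sphere, of "0::complex" 1 "u 0"] circ_in_sphere by blast
  obtain \<theta> where "a = circ \<theta>" using circ_surj[OF a(1)] .
  note a = a[unfolded this] and a_eq = this
  define G where "G = loop_plus f a"
  define U where "U i t = u i (circ (t + \<theta>))" for i t
  have G: "G t = (\<Sum>i<n. U i t)" for t
    using f[OF circ_in_sphere[of "t + \<theta>"]]
    by (simp add: G_def U_def loop_plus_def a_eq circ_add flip: circ_def)
      (simp add: mult.commute)
  have G0: "0 \<le> G 0" unfolding G U_def using nonneg by (intro sum_nonneg) auto
  have "max_forced {..1} (extension G) \<le> enat n"
    unfolding max_forced_def
  proof (rule SUP_least, clarsimp)
    fix P assume fin: "finite P" and "\<forall>x\<in>P. case x of (x, y) \<Rightarrow> forced_max {..1} (extension G) x y"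
      and "disjoint_family_on (\<lambda>(x, y). einterval x y) P"
    hence forced: "forced_max {..1} (extension G) (fst p) (snd p)" if "p \<in> P" for p
      using that by (auto simp: case_prod_beta)
    have disj: "einterval (fst p) (snd p) \<inter> einterval (fst q) (snd q) = {}"
      if "p \<in> P" "q \<in> P" "p \<noteq> q" for p q
      using \<open>disjoint_family_on _ P\<close> that by (auto simp: disjoint_family_on_def case_prod_beta)
    have lt: "fst p < snd p" and le1: "snd p \<le> 1" and pos: "0 < snd p" if "p \<in> P" for p
      using forced[OF that] einterval_subset_atMost[of "fst p" "snd p" 1] forced_max_crosses_0[of G, OF G0]
      by (auto simp: forced_max_def one_ereal_def)
    \<comment> \<open>\<open>Q\<close> consists of the intervals that begin before the starting point \<open>0\<close> of the loop.\<close>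
    define Q where "Q = {p \<in> P. fst p < 0}"
    have "p = q" if "p \<in> Q" "q \<in> Q" for p q
    proof (rule ccontr)
      assume "p \<noteq> q"
      hence "snd p \<le> fst q \<or> snd q \<le> fst p"
        using disj lt that einterval_disjoint_order by (auto simp: Q_def)
      thus False using that pos[of p] pos[of q] by (auto simp: Q_def)
    qed
    hence cardQ: "card Q \<le> 1" using fin by (simp add: card_le_Suc0_iff_eq Q_def)
    have "\<exists>i. 1 \<le> i \<and> i < n \<and> peak_between (U i) (fst p) (snd p)" if p: "p \<in> P - Q" for p
    proof -
      have "0 \<le> fst p" "fst p < 1" using p lt[of p] le1[of p] by (auto simp: Q_def)
      then obtain x where x: "fst p = ereal x" "0 \<le> x" by (cases "fst p") auto
      obtain i where i: "i < n" "peak_between (U i) (fst p) (snd p)"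
        using forced_max_peak[of G x "snd p" U n] forced[of p] p x G nonneg by (auto simp: U_def)
      have "\<not> peak_between (U 0) (fst p) (snd p)"
        unfolding U_def using unimodal_circle_no_peak_from_max[OF u[of 0] \<open>0 \<le> fst p\<close> le1[of p] a(2)] n p
        by auto
      hence "i \<noteq> 0" using i(2) by (intro notI) simp
      thus ?thesis using i by (intro exI[of _ i]) auto
    qed
    then obtain \<iota> where \<iota>: "\<And>p. p \<in> P - Q \<Longrightarrow> 1 \<le> \<iota> p \<and> \<iota> p < n \<and> peak_between (U (\<iota> p)) (fst p) (snd p)"
      by metis
    have "inj_on \<iota> (P - Q)"
    proof (rule inj_onI, rule ccontr)
      fix p q assume pq: "p \<in> P - Q" "q \<in> P - Q" "\<iota> p = \<iota> q" "p \<noteq> q"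
      have *: "\<not> snd p \<le> fst q" if pq: "p \<in> P - Q" "q \<in> P - Q" "\<iota> p = \<iota> q" for p q
      proof
        assume "snd p \<le> fst q"
        thus False
          using unimodal_circle_one_peak[of "u (\<iota> p)" "fst p" "snd q" "snd p" "fst q" \<theta>]
            \<iota>[OF pq(1)] \<iota>[OF pq(2)] pq u le1[of q] by (auto simp: U_def[abs_def] Q_def not_less)
      qed
      have "snd p \<le> fst q \<or> snd q \<le> fst p"
        using disj lt pq by (intro einterval_disjoint_order) auto
      thus False using *[of p q] *[of q p] pq by auto
    qed
    hence "card (P - Q) \<le> card {1..<n}" using \<iota> by (intro card_inj_on_le) auto
    moreover have "card P = card Q + card (P - Q)"
      using fin card_Diff_subset[of Q P] card_mono[of P Q] by (auto simp: Q_def)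
    ultimately show "card P \<le> n" using cardQ n by simp
  qed
  thus ?thesis using a(1) unfolding G_def a_eq by blast
qed

section \<open>The unimodal category in both orientations\<close>

lemma ucat_circle_eq_M_plus:
  fixes f :: "complex \<Rightarrow> real"
  assumes f: "continuous_on (sphere 0 1) f" "\<And>z. z \<in> sphere 0 1 \<Longrightarrow> 0 < f z"
    and bv: "circle_bounded_variation f"
  shows "ucat (sphere 0 1) f = max 2 (M_plus f)"
proof (rule antisym)
  have upper: "ucat (sphere 0 1) f \<le> max 2 (max_forced {..1} (extension (loop_plus f a)))"
    if a: "a \<in> sphere 0 1" for a
  proof (cases "max_forced {..1} (extension (loop_plus f a))")
    case (enat m)
    define n where "n = max 2 m"
    have "max_forced {..1} (extension (loop_plus f a)) \<le> enat n" using enat by (simp add: n_def)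
    then obtain u :: "nat \<Rightarrow> complex \<Rightarrow> real" where
      "\<forall>i<n. unimodal (sphere 0 1) (u i)" "\<forall>z\<in>sphere 0 1. f z = (\<Sum>i<n. u i z)"
      using unimodal_decomposition_of_max_forced[OF f bv a, of n] by (auto simp: n_def)
    hence "ucat (sphere 0 1) f \<le> enat n" unfolding ucat_def by (intro Inf_lower) blast
    also have "enat n = max 2 (enat m)" by (simp add: n_def numeral_eq_enat max_def)
    finally show ?thesis using enat by simp
  qed simp
  show "ucat (sphere 0 1) f \<le> max 2 (M_plus f)"
  proof (cases "ucat (sphere 0 1) f \<le> 2")
    case False
    hence "ucat (sphere 0 1) f \<le> max_forced {..1} (extension (loop_plus f a))"
      if "a \<in> sphere 0 1" for a using upper[OF that] by (auto simp: le_max_iff_disj)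
    hence "ucat (sphere 0 1) f \<le> M_plus f" unfolding M_plus_def by (intro INF_greatest)
    thus ?thesis by (simp add: le_max_iff_disj)
  qed (simp add: le_max_iff_disj)
  show "max 2 (M_plus f) \<le> ucat (sphere 0 1) f"
    unfolding ucat_def
  proof (rule Inf_greatest, clarify)
    fix n and u :: "nat \<Rightarrow> complex \<Rightarrow> real"
    assume u: "\<forall>i<n. unimodal (sphere 0 1) (u i)" and sum: "\<forall>z\<in>sphere 0 1. f z = (\<Sum>i<n. u i z)"
    have "0 < (\<Sum>i<n. u i 1)" using sum f(2)[of 1] by simp
    hence "n \<noteq> 0" by (auto intro: ccontr)
    moreover have "n \<noteq> 1"
    proof
      assume n: "n = 1"
      hence "unimodal (sphere 0 1) (u 0)" using u by simp
      then obtain z where "z \<in> sphere 0 1" "u 0 z = 0" by (rule unimodal_circle_zero)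
      thus False using f(2)[of z] sum n by simp
    qed
    ultimately have n: "2 \<le> n" by simp
    then obtain a where "a \<in> sphere 0 1" "max_forced {..1} (extension (loop_plus f a)) \<le> enat n"
      using max_forced_le_unimodal_count[of n u f] u sum by auto
    hence "M_plus f \<le> enat n" unfolding M_plus_def by (rule INF_lower2)
    thus "max 2 (M_plus f) \<le> enat n" using n by (simp add: numeral_eq_enat)
  qed
qed

lemma unimodal_circle_cnj:
  assumes "unimodal (sphere 0 1) u"
  shows "unimodal (sphere 0 1) (\<lambda>z. u (cnj z))"
proof -
  have level: "{z \<in> sphere 0 1. c \<le> u (cnj z)} = cnj ` {z \<in> sphere 0 1. c \<le> u z}" for c
  proof (intro equalityI subsetI)
    fix z assume "z \<in> {z \<in> sphere 0 1. c \<le> u (cnj z)}"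
    thus "z \<in> cnj ` {z \<in> sphere 0 1. c \<le> u z}" by (intro image_eqI[of _ _ "cnj z"]) auto
  qed auto
  have "contractible (cnj ` S) = contractible S" for S
    by (intro homeomorphic_contractible_eq homeomorphicI[of cnj _ _ cnj])
      (auto simp: image_image intro: continuous_intros)
  moreover have "continuous_on (sphere 0 1) (\<lambda>z. u (cnj z))"
    using assms unfolding unimodal_def by (elim conjE continuous_on_compose2) (auto intro: continuous_intros)
  moreover have "0 \<le> u (cnj z)" if "z \<in> sphere 0 1" for z
    using assms that unfolding unimodal_def by (metis complex_mod_cnj mem_sphere_0)
  ultimately show ?thesis using assms unfolding unimodal_def level by simp
qed

lemma ucat_circle_cnj_le: "ucat (sphere 0 1) (\<lambda>z. f (cnj z)) \<le> ucat (sphere 0 1) f"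
  unfolding ucat_def[of _ f]
proof (rule Inf_greatest, clarify)
  fix n and u :: "nat \<Rightarrow> complex \<Rightarrow> real"
  assume "\<forall>i<n. unimodal (sphere 0 1) (u i)" "\<forall>z\<in>sphere 0 1. f z = (\<Sum>i<n. u i z)"
  hence "(\<forall>i<n. unimodal (sphere 0 1) (\<lambda>z. u i (cnj z))) \<and>
      (\<forall>z\<in>sphere 0 1. f (cnj z) = (\<Sum>i<n. u i (cnj z)))"
    using unimodal_circle_cnj by auto
  thus "ucat (sphere 0 1) (\<lambda>z. f (cnj z)) \<le> enat n"
    unfolding ucat_def by (intro Inf_lower CollectI exI[of _ n] conjI exI[of _ "\<lambda>i z. u i (cnj z)"]) auto
qed

lemma ucat_circle_cnj: "ucat (sphere 0 1) (\<lambda>z. f (cnj z)) = ucat (sphere 0 1) f"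
  using ucat_circle_cnj_le[of f] ucat_circle_cnj_le[of "\<lambda>z. f (cnj z)"] by simp

lemma M_minus_eq_M_plus_cnj: "M_minus f = M_plus (\<lambda>z. f (cnj z))"
proof -
  have loop: "loop_minus f a = loop_plus (\<lambda>z. f (cnj z)) (cnj a)" for a
    by (auto simp: loop_minus_def loop_plus_def fun_eq_iff exp_cnj)
  have "sphere 0 1 = cnj ` sphere 0 1"
    by (force intro: image_eqI[of _ cnj "cnj _"])
  hence "M_plus (\<lambda>z. f (cnj z)) =
      (INF a\<in>cnj ` sphere 0 1. max_forced {..1} (extension (loop_plus (\<lambda>z. f (cnj z)) a)))"
    unfolding M_plus_def by simp
  thus ?thesis by (simp add: M_minus_def loop image_image)
qed

lemma circle_bounded_variation_cnj:
  assumes "circle_bounded_variation f"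
  shows "circle_bounded_variation (\<lambda>z. f (cnj z))"
proof -
  define F where "F t = f (circ t)" for t
  obtain B where B: "\<And>k c. (k, c) \<in> chains {0..1} \<Longrightarrow> (\<Sum>i<k. \<bar>F (c (Suc i)) - F (c i)\<bar>) \<le> B"
    using assms unfolding circle_bounded_variation_def has_bounded_variation_on_def F_def circ_def
    by auto
  have flip: "f (cnj (circ t)) = F (1 - t)" for t
  proof -
    have "circ (1 - t) = circ (- t)" using circ_add[of 1 "- t"] by simp
    thus ?thesis by (simp add: F_def circ_eq_cis cis_cnj)
  qed
  have "(\<Sum>i<k. \<bar>F (1 - c (Suc i)) - F (1 - c i)\<bar>) \<le> B" if c: "(k, c) \<in> chains {0..1}" for k c
  proof -
    define b where "b i = 1 - c (k - i)" for i
    have "(k, b) \<in> chains {0..1}"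
      using c by (auto simp: chains_def b_def strict_mono_on_def image_subset_iff)
    hence "(\<Sum>i<k. \<bar>F (b (Suc i)) - F (b i)\<bar>) \<le> B" by (rule B)
    also have "(\<Sum>i<k. \<bar>F (b (Suc i)) - F (b i)\<bar>)
        = (\<Sum>i<k. \<bar>F (1 - c (Suc (k - Suc i))) - F (1 - c (k - Suc i))\<bar>)"
      by (intro sum.cong) (auto simp: b_def Suc_diff_Suc abs_minus_commute)
    also have "\<dots> = (\<Sum>i<k. \<bar>F (1 - c (Suc i)) - F (1 - c i)\<bar>)"
      by (rule sum.nat_diff_reindex)
    finally show ?thesis .
  qed
  thus ?thesis
    unfolding circle_bounded_variation_def has_bounded_variation_on_def
    by (intro exI[of _ B]) (auto simp: flip simp flip: circ_def)
qed

theorem theorem3p12: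
  fixes f :: "complex \<Rightarrow> real"
  assumes "continuous_on (sphere 0 1) f"
    and "\<And>z. z \<in> sphere 0 1 \<Longrightarrow> 0 \<le> f z"
    and "\<And>z. z \<in> sphere 0 1 \<Longrightarrow> f z \<noteq> 0"
    and "circle_bounded_variation f"
  shows "ucat (sphere 0 1) f = max 2 (M_plus f) \<and> ucat (sphere 0 1) f = max 2 (M_minus f)"
proof
  have pos: "0 < f z" if "z \<in> sphere 0 1" for z using assms(2,3)[OF that] by simp
  show "ucat (sphere 0 1) f = max 2 (M_plus f)"
    by (rule ucat_circle_eq_M_plus[OF assms(1) pos assms(4)])
  have "continuous_on (sphere 0 1) (\<lambda>z. f (cnj z))"
    by (rule continuous_on_compose2[OF assms(1)]) (auto intro: continuous_intros)
  hence "ucat (sphere 0 1) (\<lambda>z. f (cnj z)) = max 2 (M_plus (\<lambda>z. f (cnj z)))"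
    by (rule ucat_circle_eq_M_plus) (use pos circle_bounded_variation_cnj[OF assms(4)] in auto)
  thus "ucat (sphere 0 1) f = max 2 (M_minus f)"
    by (simp only: ucat_circle_cnj M_minus_eq_M_plus_cnj)
qed

end
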